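(* Let $0<n<\omega$ and let $L$ be a normal monomodal logic containing $K4I_n$. If $L$ is $\omega$-canonical, then $L$ is totally canonical.
   Context: Monomodal formulas are built from countably many atoms $q_0,q_1,\dots$ using $\top,\neg,\vee,\Diamond$, with $\Box\varphi=\neg\Diamond\neg\varphi$. A normal modal logic is a set of formulas containing all propositional tautologies, $\Box(p\to q)\to(\Box p\to\Box q)$ and $\Diamond p\leftrightarrow\neg\Box\neg p$, and closed under modus ponens, generalisation and uniform substitution. $K4I_n$ is the smallest normal modal logic containing the axioms $\Diamond\Diamond p\to\Diamond p$ and $$I_n=\Bigl(\bigwedge_{i\le n}\Diamond q_i\Bigr)\to\bigvee_{i,j\le n,\,i\ne j}\Diamond\bigl(q_i\wedge(q_j\vee\Diamond q_j)\bigr).$$ Logics containing some $K4I_n$ are called logics of finite width. A $\{\Diamond\}$-BAO is a boolean algebra $\mathcal A$ with an operation $\Diamond$ satisfying $\Diamond 0=0$ and $\Diamond(a+b)=\Diamond a+\Diamond b$. Formulas translate to algebra terms in the usual way (atoms become variables); $V_L$ denotes the variety of all $\{\Diamond\}$-BAOs in which the term translating each $\varphi\in L$ is identically $1$. The canonical frame $\mathcal A_+$ has the ultrafilters of $\mathcal A$ as points, with $R_\Diamond\mu\nu$ iff $\Diamond a\in\mu$ for every $a\in\nu$. The canonical extension $\mathcal A^\sigma$ is the algebra of all subsets of $\mathcal A_+$ with $\Diamond X=\{\mu:\exists\nu\in X\ R_\Diamond\mu\nu\}$. For a cardinal $\kappa$, $L$ is $\kappa$-canonical if $\mathcal A^\sigma\in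 V_L$ for every $\mathcal A\in V_L$ that is generated as an algebra by a subset of cardinality at most $\kappa$ (equivalently, every canonical frame of $L$ defined using at most $\kappa$ atoms validates $L$). $L$ is totally canonical if $\mathcal A^\sigma\in V_L$ for every $\mathcal A\in V_L$. *)

theory Defs
  imports "HOL-Library.Countable_Set_Type" "HOL-Algebra.Congruence"
begin

unbundle cardinal_syntax

section \<open>Monomodal formulas and normal logics\<close>

datatype fm = Atom nat | Top | Neg fm | Or fm fm | Dia fm

definition Bot :: fm where "Bot = Neg Top"
definition And :: "fm \<Rightarrow> fm \<Rightarrow> fm" where "And p q = Neg (Or (Neg p) (Neg q))"
definition Imp :: "fm \<Rightarrow> fm \<Rightarrow> fm" where "Imp p q = Or (Neg p) q"
definition Iff :: "fm \<Rightarrow> fm \<Rightarrow> fm" where "Iff p q = And (Imp p q) (Imp q p)"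
definition Box :: "fm \<Rightarrow> fm" where "Box p = Neg (Dia (Neg p))"

definition Conj_list :: "fm list \<Rightarrow> fm" where "Conj_list ps = foldr And ps Top"
definition Disj_list :: "fm list \<Rightarrow> fm" where "Disj_list ps = foldr Or ps Bot"

primrec subst :: "(nat \<Rightarrow> fm) \<Rightarrow> fm \<Rightarrow> fm" where
  "subst s (Atom i) = s i"
| "subst s Top = Top"
| "subst s (Neg p) = Neg (subst s p)"
| "subst s (Or p q) = Or (subst s p) (subst s q)"
| "subst s (Dia p) = Dia (subst s p)"

text \<open>
  For propositional logic, a formula of the form \<open>Dia p\<close> is as unanalysed as an atom:
  \<open>d p\<close> is the truth value given to \<open>Dia p\<close>.
\<close>

primrec prop_eval :: "(nat \<Rightarrow> bool) \<Rightarrow> (fm \<Rightarrow> bool) \<Rightarrow> fm \<Rightarrow> bool" where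
  "prop_eval v d (Atom i) = v i"
| "prop_eval v d Top = True"
| "prop_eval v d (Neg p) = (\<not> prop_eval v d p)"
| "prop_eval v d (Or p q) = (prop_eval v d p \<or> prop_eval v d q)"
| "prop_eval v d (Dia p) = d p"

definition tautology :: "fm \<Rightarrow> bool" where
  "tautology p \<longleftrightarrow> (\<forall>v d. prop_eval v d p)"

definition K_axiom :: fm where
  "K_axiom = Imp (Box (Imp (Atom 0) (Atom 1))) (Imp (Box (Atom 0)) (Box (Atom 1)))"

definition Dual_axiom :: fm where
  "Dual_axiom = Iff (Dia (Atom 0)) (Neg (Box (Neg (Atom 0))))"

definition normal_modal_logic :: "fm set \<Rightarrow> bool" where
  "normal_modal_logic L \<longleftrightarrow>
     {p. tautology p} \<subseteq> L \<and> K_axiom \<in> L \<and> Dual_axiom \<in> L \<and>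
     (\<forall>p q. Imp p q \<in> L \<longrightarrow> p \<in> L \<longrightarrow> q \<in> L) \<and>
     (\<forall>p. p \<in> L \<longrightarrow> Box p \<in> L) \<and>
     (\<forall>s p. p \<in> L \<longrightarrow> subst s p \<in> L)"

definition Four_axiom :: fm where
  "Four_axiom = Imp (Dia (Dia (Atom 0))) (Dia (Atom 0))"

definition I_axiom :: "nat \<Rightarrow> fm" where
  "I_axiom n =
     Imp (Conj_list [Dia (Atom i). i \<leftarrow> [0..<Suc n]])
         (Disj_list [Dia (And (Atom i) (Or (Atom j) (Dia (Atom j)))).
                       i \<leftarrow> [0..<Suc n], j \<leftarrow> [0..<Suc n], i \<noteq> j])"

definition K4I :: "nat \<Rightarrow> fm set" where
  "K4I n = \<Inter> {L. normal_modal_logic L \<and> Four_axiom \<in> L \<and> I_axiom n \<in> L}"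


section \<open>Boolean algebras with an operator\<close>

record 'a bao = "'a partial_object" +
  zero :: 'a
  one :: 'a
  join :: "'a \<Rightarrow> 'a \<Rightarrow> 'a"
  meet :: "'a \<Rightarrow> 'a \<Rightarrow> 'a"
  compl :: "'a \<Rightarrow> 'a"
  dia :: "'a \<Rightarrow> 'a"

text \<open>The one-element algebra, in which \<open>zero A = one A\<close>, is not excluded.\<close>

locale boolean_alg =
  fixes A :: "'a bao"
  assumes zero_closed: "zero A \<in> carrier A"
    and one_closed: "one A \<in> carrier A"
    and join_closed: "\<lbrakk>x \<in> carrier A; y \<in> carrier A\<rbrakk> \<Longrightarrow> join A x y \<in> carrier A"
    and meet_closed: "\<lbrakk>x \<in> carrier A; y \<in> carrier A\<rbrakk> \<Longrightarrow> meet A x y \<in> carrier A"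
    and compl_closed: "x \<in> carrier A \<Longrightarrow> compl A x \<in> carrier A"
    and join_assoc: "\<lbrakk>x \<in> carrier A; y \<in> carrier A; z \<in> carrier A\<rbrakk>
          \<Longrightarrow> join A (join A x y) z = join A x (join A y z)"
    and meet_assoc: "\<lbrakk>x \<in> carrier A; y \<in> carrier A; z \<in> carrier A\<rbrakk>
          \<Longrightarrow> meet A (meet A x y) z = meet A x (meet A y z)"
    and join_comm: "\<lbrakk>x \<in> carrier A; y \<in> carrier A\<rbrakk> \<Longrightarrow> join A x y = join A y x"
    and meet_comm: "\<lbrakk>x \<in> carrier A; y \<in> carrier A\<rbrakk> \<Longrightarrow> meet A x y = meet A y x"
    and meet_join_distrib: "\<lbrakk>x \<in> carrier A; y \<in> carrier A; z \<in> carrier A\<rbrakk>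
          \<Longrightarrow> meet A x (join A y z) = join A (meet A x y) (meet A x z)"
    and join_meet_distrib: "\<lbrakk>x \<in> carrier A; y \<in> carrier A; z \<in> carrier A\<rbrakk>
          \<Longrightarrow> join A x (meet A y z) = meet A (join A x y) (join A x z)"
    and join_zero: "x \<in> carrier A \<Longrightarrow> join A x (zero A) = x"
    and meet_one: "x \<in> carrier A \<Longrightarrow> meet A x (one A) = x"
    and join_compl: "x \<in> carrier A \<Longrightarrow> join A x (compl A x) = one A"
    and meet_compl: "x \<in> carrier A \<Longrightarrow> meet A x (compl A x) = zero A"

locale dia_bao = boolean_alg +
  assumes dia_closed: "x \<in> carrier A \<Longrightarrow> dia A x \<in> carrier A"
    and dia_zero: "dia A (zero A) = zero A"
    and dia_join: "\<lbrakk>x \<in> carrier A; y \<in> carrier A\<rbrakk>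
          \<Longrightarrow> dia A (join A x y) = join A (dia A x) (dia A y)"

inductive_set generated :: "'a bao \<Rightarrow> 'a set \<Rightarrow> 'a set" for A G where
  gen_base: "x \<in> G \<Longrightarrow> x \<in> generated A G"
| gen_zero: "zero A \<in> generated A G"
| gen_one: "one A \<in> generated A G"
| gen_join: "x \<in> generated A G \<Longrightarrow> y \<in> generated A G \<Longrightarrow> join A x y \<in> generated A G"
| gen_meet: "x \<in> generated A G \<Longrightarrow> y \<in> generated A G \<Longrightarrow> meet A x y \<in> generated A G"
| gen_compl: "x \<in> generated A G \<Longrightarrow> compl A x \<in> generated A G"
| gen_dia: "x \<in> generated A G \<Longrightarrow> dia A x \<in> generated A G"

primrec term_val :: "'a bao \<Rightarrow> (nat \<Rightarrow> 'a) \<Rightarrow> fm \<Rightarrow> 'a" where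
  "term_val A v (Atom i) = v i"
| "term_val A v Top = one A"
| "term_val A v (Neg p) = compl A (term_val A v p)"
| "term_val A v (Or p q) = join A (term_val A v p) (term_val A v q)"
| "term_val A v (Dia p) = dia A (term_val A v p)"

text \<open>\<open>in_variety A L\<close> says that \<open>A\<close> belongs to the variety \<open>V\<^sub>L\<close>.\<close>

definition in_variety :: "'a bao \<Rightarrow> fm set \<Rightarrow> bool" where
  "in_variety A L \<longleftrightarrow> dia_bao A \<and>
     (\<forall>p\<in>L. \<forall>v. (\<forall>i. v i \<in> carrier A) \<longrightarrow> term_val A v p = one A)"


section \<open>Canonical frames and canonical extensions\<close>

definition ultrafilter_of :: "'a bao \<Rightarrow> 'a set \<Rightarrow> bool" where
  "ultrafilter_of A F \<longleftrightarrow> F \<subseteq> carrier A \<and> one A \<in> F \<and> zero A \<notin> F \<and>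
     (\<forall>x\<in>F. \<forall>y\<in>F. meet A x y \<in> F) \<and>
     (\<forall>x\<in>F. \<forall>y\<in>carrier A. meet A x y = x \<longrightarrow> y \<in> F) \<and>
     (\<forall>x\<in>carrier A. x \<in> F \<or> compl A x \<in> F)"

definition canonical_points :: "'a bao \<Rightarrow> 'a set set" where
  "canonical_points A = {F. ultrafilter_of A F}"

definition canonical_rel :: "'a bao \<Rightarrow> 'a set \<Rightarrow> 'a set \<Rightarrow> bool" where
  "canonical_rel A \<mu> \<nu> \<longleftrightarrow> (\<forall>a\<in>\<nu>. dia A a \<in> \<mu>)"

definition complex_algebra :: "'w set \<Rightarrow> ('w \<Rightarrow> 'w \<Rightarrow> bool) \<Rightarrow> 'w set bao" where
  "complex_algebra W R =
     \<lparr>carrier = Pow W, zero = {}, one = W, join = (\<union>), meet = (\<inter>),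
      compl = (\<lambda>X. W - X), dia = (\<lambda>X. {w \<in> W. \<exists>v\<in>X. R w v})\<rparr>"

definition canonical_extension :: "'a bao \<Rightarrow> 'a set set bao" where
  "canonical_extension A = complex_algebra (canonical_points A) (canonical_rel A)"


section \<open>Canonicity\<close>

text \<open>
  Cardinals are those of HOL's ordinal and cardinal library; \<open>\<omega>\<close> is \<open>natLeq\<close>.
  A formula cannot quantify over types, so the type \<open>'a\<close> from which the carriers of the algebras
  are drawn is an explicit argument. Algebras generated by at most \<open>\<omega>\<close> elements are countable,
  so for \<open>\<kappa> = \<omega>\<close> the type \<open>nat\<close> covers all of them up to isomorphism: by
  \<open>omega_canonical_all_types\<close> below, \<open>kappa_canonical natLeq TYPE(nat) L\<close> implies
  \<open>kappa_canonical natLeq TYPE('a) L\<close> for every type \<open>'a\<close>.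
\<close>

definition kappa_canonical :: "'k rel \<Rightarrow> 'a itself \<Rightarrow> fm set \<Rightarrow> bool" where
  "kappa_canonical \<kappa> (T :: 'a itself) L \<longleftrightarrow>
     (\<forall>A :: 'a bao. in_variety A L \<longrightarrow>
        (\<exists>G \<subseteq> carrier A. |G| \<le>o \<kappa> \<and> generated A G = carrier A) \<longrightarrow>
        in_variety (canonical_extension A) L)"

definition totally_canonical :: "'a itself \<Rightarrow> fm set \<Rightarrow> bool" where
  "totally_canonical (T :: 'a itself) L \<longleftrightarrow>
     (\<forall>A :: 'a bao. in_variety A L \<longrightarrow> in_variety (canonical_extension A) L)"


section \<open>Independence of the carrier type\<close>

lemma dia_bao_complex_algebra: "dia_bao (complex_algebra W R)"
  by unfold_locales (auto simp: complex_algebra_def)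

definition bao_iso :: "('a \<Rightarrow> 'b) \<Rightarrow> 'a bao \<Rightarrow> 'b bao \<Rightarrow> bool" where
  "bao_iso h A B \<longleftrightarrow> bij_betw h (carrier A) (carrier B) \<and>
     h (zero A) = zero B \<and> h (one A) = one B \<and>
     (\<forall>x\<in>carrier A. \<forall>y\<in>carrier A. h (join A x y) = join B (h x) (h y)) \<and>
     (\<forall>x\<in>carrier A. \<forall>y\<in>carrier A. h (meet A x y) = meet B (h x) (h y)) \<and>
     (\<forall>x\<in>carrier A. h (compl A x) = compl B (h x)) \<and>
     (\<forall>x\<in>carrier A. h (dia A x) = dia B (h x))"

context
  fixes h :: "'a \<Rightarrow> 'b" and A :: "'a bao" and B :: "'b bao"
  assumes iso: "bao_iso h A B" and A: "dia_bao A"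
begin

interpretation A: dia_bao A by (rule A)

lemma iso_inj: "inj_on h (carrier A)"
  and iso_im: "h ` carrier A = carrier B"
  and iso_zero: "h (zero A) = zero B"
  and iso_one: "h (one A) = one B"
  and iso_join: "x \<in> carrier A \<Longrightarrow> y \<in> carrier A \<Longrightarrow> h (join A x y) = join B (h x) (h y)"
  and iso_meet: "x \<in> carrier A \<Longrightarrow> y \<in> carrier A \<Longrightarrow> h (meet A x y) = meet B (h x) (h y)"
  and iso_compl: "x \<in> carrier A \<Longrightarrow> h (compl A x) = compl B (h x)"
  and iso_dia: "x \<in> carrier A \<Longrightarrow> h (dia A x) = dia B (h x)"
  using iso by (auto simp: bao_iso_def bij_betw_def)

lemmas A_closed = A.zero_closed A.one_closed A.join_closed A.meet_closed A.compl_closed A.dia_closed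
lemmas iso_hom = iso_zero iso_one iso_join iso_meet iso_compl iso_dia

lemma iso_dia_bao: "dia_bao B"
  by (unfold_locales; unfold iso_im[symmetric] iso_zero[symmetric] iso_one[symmetric];
      (elim imageE)?; hypsubst?; (simp (no_asm_simp) only: iso_hom[symmetric] A_closed)?;
      (rule imageI arg_cong[where f = h])?;
      (intro A.join_assoc A.meet_assoc A.join_comm A.meet_comm A.meet_join_distrib
        A.join_meet_distrib A.join_zero A.meet_one A.join_compl A.meet_compl A.dia_zero A.dia_join
        A_closed)?; assumption?)

lemma term_val_closed: "(\<And>i. v i \<in> carrier A) \<Longrightarrow> term_val A v p \<in> carrier A"
  by (induction p) (auto intro: A_closed)

lemma iso_term_val:
  "(\<And>i. v i \<in> carrier A) \<Longrightarrow> h (term_val A v p) = term_val B (\<lambda>i. h (v i)) p"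
  by (induction p) (simp_all add: iso_hom term_val_closed)

lemma iso_in_variety:
  assumes "in_variety A L"
  shows "in_variety B L"
  unfolding in_variety_def
proof (intro conjI ballI allI impI iso_dia_bao)
  fix p and v :: "nat \<Rightarrow> 'b" assume p: "p \<in> L" and v: "\<forall>i. v i \<in> carrier B"
  then have "\<exists>w. \<forall>i. w i \<in> carrier A \<and> h (w i) = v i"
    by (intro choice) (metis imageE iso_im)
  then obtain w where w: "\<And>i. w i \<in> carrier A" "v = (\<lambda>i. h (w i))" by metis
  then show "term_val B v p = one B"
    using assms p iso_term_val[of w p] by (simp add: in_variety_def iso_one)
qed

lemma iso_inv: "bao_iso (inv_into (carrier A) h) B A"
  using iso_inj
  by (auto simp: bao_iso_def iso_im[symmetric] iso_hom[symmetric] A_closed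
      intro!: bij_betw_inv_into inj_on_imp_bij_betw)

lemma generated_closed: "G \<subseteq> carrier A \<Longrightarrow> x \<in> generated A G \<Longrightarrow> x \<in> carrier A"
  by (rotate_tac 1, induction rule: generated.induct) (auto intro: A_closed)

lemma iso_generated:
  assumes G: "G \<subseteq> carrier A" and gen: "generated A G = carrier A"
  shows "generated B (h ` G) = carrier B"
proof
  have "h x \<in> generated B (h ` G)" if "x \<in> generated A G" for x
    using that
    by induction
      (auto simp: iso_hom generated_closed[OF G] intro: generated.intros)
  then show "carrier B \<subseteq> generated B (h ` G)"
    unfolding iso_im[symmetric] gen by (rule image_subsetI)
  interpret B: dia_bao B by (rule iso_dia_bao)
  show "generated B (h ` G) \<subseteq> carrier B"
  proof
    fix y assume "y \<in> generated B (h ` G)"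
    then show "y \<in> carrier B"
    proof induction
      case (gen_base y)
      then show ?case using G iso_im by blast
    qed (auto intro: B.zero_closed B.one_closed B.join_closed B.meet_closed
          B.compl_closed B.dia_closed)
  qed
qed

lemma iso_ultrafilter:
  assumes "ultrafilter_of A F"
  shows "ultrafilter_of B (h ` F)"
proof -
  have F: "F \<subseteq> carrier A" using assms by (simp add: ultrafilter_of_def)
  have mem: "h x \<in> h ` F \<longleftrightarrow> x \<in> F" if "x \<in> carrier A" for x
    by (rule inj_on_image_mem_iff[OF iso_inj that F])
  have eq: "h x = h y \<longleftrightarrow> x = y" if "x \<in> carrier A" "y \<in> carrier A" for x y
    using iso_inj that by (auto dest: inj_onD)
  have up: "h y \<in> h ` F" if "x \<in> F" "y \<in> carrier A" "meet B (h x) (h y) = h x" for x y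
  proof -
    have x: "x \<in> carrier A" using F that(1) by blast
    have "meet A x y = x"
      using that(3) unfolding iso_meet[OF x that(2), symmetric]
      by (simp add: eq x that(2) A.meet_closed)
    then show ?thesis using assms that(1,2) unfolding ultrafilter_of_def by blast
  qed
  have inter: "meet B (h x) (h y) \<in> h ` F" if "x \<in> F" "y \<in> F" for x y
  proof -
    have "x \<in> carrier A" "y \<in> carrier A" using F that by blast+
    moreover have "meet A x y \<in> F" using assms that by (simp add: ultrafilter_of_def)
    ultimately show ?thesis by (simp flip: iso_meet)
  qed
  have alt: "h x \<in> h ` F \<or> compl B (h x) \<in> h ` F" if "x \<in> carrier A" for x
    using assms that by (auto simp: ultrafilter_of_def simp flip: iso_compl)
  have "h ` F \<subseteq> h ` carrier A" using F by (rule image_mono)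
  moreover have "h (one A) \<in> h ` F" "h (zero A) \<notin> h ` F"
    using assms mem[OF A.zero_closed] by (auto simp: ultrafilter_of_def)
  ultimately show ?thesis
    unfolding ultrafilter_of_def iso_im[symmetric] iso_zero[symmetric] iso_one[symmetric]
      ball_simps(9)
    using inter up alt by simp
qed

lemma iso_canonical_rel:
  assumes "\<mu> \<in> canonical_points A" "\<nu> \<in> canonical_points A"
  shows "canonical_rel B (h ` \<mu>) (h ` \<nu>) \<longleftrightarrow> canonical_rel A \<mu> \<nu>"
proof -
  have sub: "\<mu> \<subseteq> carrier A" "\<nu> \<subseteq> carrier A"
    using assms by (auto simp: canonical_points_def ultrafilter_of_def)
  have "dia B (h a) \<in> h ` \<mu> \<longleftrightarrow> dia A a \<in> \<mu>" if "a \<in> \<nu>" for a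
  proof -
    have a: "a \<in> carrier A" using that sub by blast
    show ?thesis
      unfolding iso_dia[OF a, symmetric]
      by (rule inj_on_image_mem_iff[OF iso_inj A.dia_closed[OF a] sub(1)])
  qed
  then show ?thesis by (simp add: canonical_rel_def)
qed

end

lemma iso_canonical_points:
  assumes "bao_iso h A B" "dia_bao A"
  shows "bij_betw (image h) (canonical_points A) (canonical_points B)"
  unfolding bij_betw_def
proof
  note inj = iso_inj[OF assms]
  show "inj_on (image h) (canonical_points A)"
    by (rule inj_on_subset[OF inj_on_image_Pow[OF inj]])
      (auto simp: canonical_points_def ultrafilter_of_def)
  have "F \<in> image h ` canonical_points A" if F: "F \<in> canonical_points B" for F
  proof
    let ?g = "inv_into (carrier A) h"
    show "?g ` F \<in> canonical_points A"
      using iso_ultrafilter[OF iso_inv[OF assms] iso_dia_bao[OF assms]] F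
      by (simp add: canonical_points_def)
    have "F \<subseteq> h ` carrier A"
      using F iso_im[OF assms] by (auto simp: canonical_points_def ultrafilter_of_def)
    then show "F = h ` ?g ` F"
      by (simp add: image_inv_into_cancel)
  qed
  moreover have "h ` F \<in> canonical_points B" if "F \<in> canonical_points A" for F
    using iso_ultrafilter[OF assms] that by (simp add: canonical_points_def)
  ultimately show "image h ` canonical_points A = canonical_points B"
    by blast
qed

lemma iso_canonical_extension:
  assumes "bao_iso h A B" "dia_bao A"
  shows "bao_iso (image (image h)) (canonical_extension A) (canonical_extension B)"
proof -
  note bij = iso_canonical_points[OF assms]
  let ?W = "canonical_points A"
  have im: "image h ` ?W = canonical_points B" and inj: "inj_on (image h) ?W"
    using bij by (auto simp: bij_betw_def)
  have dia: "image (image h) {\<mu> \<in> ?W. \<exists>\<nu>\<in>X. canonical_rel A \<mu> \<nu>} =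
      {\<mu> \<in> canonical_points B. \<exists>\<nu>\<in>image (image h) X. canonical_rel B \<mu> \<nu>}" if X: "X \<subseteq> ?W" for X
  proof -
    have rel: "(\<exists>\<nu>\<in>image (image h) X. canonical_rel B (h ` \<mu>) \<nu>) \<longleftrightarrow>
        (\<exists>\<nu>\<in>X. canonical_rel A \<mu> \<nu>)" if "\<mu> \<in> ?W" for \<mu>
    proof -
      have "canonical_rel B (h ` \<mu>) (h ` \<nu>) \<longleftrightarrow> canonical_rel A \<mu> \<nu>" if "\<nu> \<in> X" for \<nu>
        using iso_canonical_rel[OF assms \<open>\<mu> \<in> ?W\<close>] X that by blast
      then show ?thesis by simp
    qed
    have image_filter: "f ` {w \<in> W. P w} = {y \<in> f ` W. Q y}"
      if "\<And>w. w \<in> W \<Longrightarrow> Q (f w) \<longleftrightarrow> P w" for f :: "'a set \<Rightarrow> 'b set" and W P Q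
      using that by blast
    show ?thesis unfolding im[symmetric] by (rule image_filter) (rule rel)
  qed
  have bijP: "bij_betw (image (image h)) (Pow ?W) (Pow (canonical_points B))"
    by (rule bij_betw_Pow[OF bij])
  have int: "image (image h) (X \<inter> Y) = image (image h) X \<inter> image (image h) Y"
    if "X \<subseteq> ?W" "Y \<subseteq> ?W" for X Y
    by (rule inj_on_image_Int[OF inj that])
  have diff: "image (image h) (?W - X) = canonical_points B - image (image h) X"
    if "X \<subseteq> ?W" for X
    using inj_on_image_set_diff[OF inj _ that, of ?W] im by simp
  show ?thesis
    unfolding bao_iso_def canonical_extension_def complex_algebra_def
      bao.simps partial_object.simps Pow_iff
    by (intro conjI ballI bijP image_empty im image_Un int diff dia) (simp_all only: Pow_iff)
qed

lemma countable_generated: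
  assumes "countable G"
  shows "countable (generated A G)"
proof -
  define step where "step X = X \<union> (\<Union>x\<in>X. \<Union>y\<in>X. {join A x y, meet A x y, compl A x, dia A x})"
    for X
  define C where "C k = (step ^^ k) (insert (zero A) (insert (one A) G))" for k
  have "countable (C k)" for k
    by (induction k) (use assms in \<open>auto simp: C_def step_def\<close>)
  moreover have "generated A G \<subseteq> (\<Union>k. C k)"
  proof
    have mono: "C i \<subseteq> C j" if "i \<le> j" for i j
      using that by (rule lift_Suc_mono_le[rotated]) (auto simp: C_def step_def)
    have two: "\<exists>k. x \<in> C k \<and> y \<in> C k" if "x \<in> (\<Union>k. C k)" "y \<in> (\<Union>k. C k)" for x y
      using that mono by (metis UN_E max.cobounded1 max.cobounded2 subsetD)
    have Suc: "join A x y \<in> C (Suc k)" "meet A x y \<in> C (Suc k)"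
      "compl A x \<in> C (Suc k)" "dia A x \<in> C (Suc k)"
      if "x \<in> C k" "y \<in> C k" for x y k
      using that by (auto simp: C_def step_def)
    have base: "x \<in> C 0" if "x \<in> insert (zero A) (insert (one A) G)" for x
      using that by (simp add: C_def)
    fix x assume "x \<in> generated A G"
    then show "x \<in> (\<Union>k. C k)"
    proof induction
      case (gen_join x y)
      then obtain k where "x \<in> C k" "y \<in> C k" using two by blast
      then show ?case using Suc(1) by blast
    next
      case (gen_meet x y)
      then obtain k where "x \<in> C k" "y \<in> C k" using two by blast
      then show ?case using Suc(2) by blast
    next
      case (gen_compl x)
      then obtain k where "x \<in> C k" by blast
      then show ?case using Suc(3) by blast
    next
      case (gen_dia x)
      then obtain k where "x \<in> C k" by blast
      then show ?case using Suc(4) by blast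
    qed (use base in blast)+
  qed
  ultimately show ?thesis
    by (meson countable_UN countable_subset countableI_type)
qed

lemma omega_canonical_all_types:
  assumes "kappa_canonical natLeq TYPE(nat) L"
  shows "kappa_canonical natLeq TYPE('a) L"
  unfolding kappa_canonical_def
proof (intro allI impI)
  fix A :: "'a bao"
  assume var: "in_variety A L"
    and "\<exists>G\<subseteq>carrier A. |G| \<le>o natLeq \<and> generated A G = carrier A"
  then obtain G where G: "G \<subseteq> carrier A" "|G| \<le>o natLeq" "generated A G = carrier A" by blast
  have A: "dia_bao A" using var by (simp add: in_variety_def)
  interpret A: dia_bao A by (rule A)
  have cnt: "countable G" using G(2) by (simp add: countable_card_le_natLeq)
  then have "countable (carrier A)" using countable_generated G(3) by metis
  then obtain h :: "'a \<Rightarrow> nat" where h: "inj_on h (carrier A)" by (auto simp: countable_def)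
  define g where "g = inv_into (carrier A) h"
  define B :: "nat bao" where "B = \<lparr>carrier = h ` carrier A, zero = h (zero A), one = h (one A),
    join = (\<lambda>x y. h (join A (g x) (g y))), meet = (\<lambda>x y. h (meet A (g x) (g y))),
    compl = (\<lambda>x. h (compl A (g x))), dia = (\<lambda>x. h (dia A (g x)))\<rparr>"
  have iso: "bao_iso h A B"
    using h by (simp add: bao_iso_def B_def g_def inj_on_imp_bij_betw)
  have "in_variety B L" by (rule iso_in_variety[OF iso A var])
  moreover have "generated B (h ` G) = carrier B" by (rule iso_generated[OF iso A G(1,3)])
  moreover have "h ` G \<subseteq> carrier B" using G(1) by (auto simp: B_def)
  moreover have "|h ` G| \<le>o natLeq" using cnt by (simp flip: countable_card_le_natLeq)
  ultimately have B: "in_variety (canonical_extension B) L"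
    using assms unfolding kappa_canonical_def by blast
  have "bao_iso (image (image h)) (canonical_extension A) (canonical_extension B)"
    by (rule iso_canonical_extension[OF iso A])
  from iso_inv[OF this] have "bao_iso (inv_into (carrier (canonical_extension A)) (image (image h)))
      (canonical_extension B) (canonical_extension A)"
    by (simp add: canonical_extension_def dia_bao_complex_algebra)
  from iso_in_variety[OF this _ B] show "in_variety (canonical_extension A) L"
    by (simp add: canonical_extension_def dia_bao_complex_algebra)
qed

end

theory Submission
  imports Defs
begin

text \<open>
  Suppose that \<open>A\<close> is in the variety of \<open>L\<close> and that some formula of \<open>L\<close> fails at a point \<open>w\<close> of the
  canonical frame of \<open>A\<close> under a valuation \<open>V\<close> by arbitrary sets of points. The plan is to refute the
  same formula in the canonical frame of a countable subalgebra \<open>B\<close> of \<open>A\<close>. Since \<open>B\<close> is again in the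
  variety of \<open>L\<close> and is countably generated, this contradicts \<open>\<omega>\<close>-canonicity.

  A Loewenheim-Skolem argument gives a countable set \<open>M\<close> of points with \<open>w\<close> in \<open>M\<close>, closed under
  witnesses for the diamond subformulas, and a countable subalgebra \<open>B\<close> rich enough that restriction
  to \<open>B\<close> embeds \<open>M\<close>, with its accessibility relation, in the frame of \<open>B\<close>. The frame of \<open>B\<close> has many
  more points, however, and they must not spoil the refutation. Each such point \<open>z\<close> above \<open>w\<close> is
  therefore made to imitate a point \<open>r\<close> of \<open>M\<close>. Two things are needed of \<open>r\<close>: that \<open>z\<close> sees it, and
  that \<open>Dia \<psi>\<close> holds at \<open>r\<close> exactly for those of the relevant formulas \<open>\<psi>\<close> that hold somewhere in \<open>M\<close>
  above \<open>z\<close>.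

  Both follow once the points of \<open>M\<close> above \<open>z\<close> are directed downwards, in the sense that for every
  finite set \<open>S\<close> of them, \<open>z\<close> sees some \<open>r\<close> in \<open>M\<close> that sees all of \<open>S\<close>. This is where finite width
  enters. The points above \<open>w\<close> that see every point of \<open>S\<close> form a closed set in the canonical frame
  of \<open>A\<close>. In a transitive canonical frame every point of such a set equals or sees a maximal
  point of it (\<open>ex_maximal_in_cone_below\<close>), and by finite width, \<open>antichain_card\<close>, there are only
  finitely many maximal points up to mutual accessibility (\<open>finite_cofinal_in_cone_below\<close>).
  Representatives of all of them can hence be put in the countable set \<open>M\<close>. The point \<open>z\<close> lifts to a
  point of the closed set (\<open>lift_point\<close>); the lift equals or sees one of the representatives, and this
  is the desired \<open>r\<close> unless \<open>z\<close> is itself the restriction of a point of \<open>M\<close>. The resulting imitation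
  is \<open>ex_imitation\<close>, the transfer of the refutation is \<open>ex_valuation\<close>, and \<open>ex_countable_reflection\<close>
  provides \<open>M\<close> and \<open>B\<close>.
\<close>

section \<open>Ultrafilters of a Boolean algebra\<close>

context boolean_alg
begin

lemma meet_left_comm:
  "\<lbrakk>x \<in> carrier A; y \<in> carrier A; z \<in> carrier A\<rbrakk>
    \<Longrightarrow> meet A x (meet A y z) = meet A y (meet A x z)"
  by (metis meet_assoc meet_comm)

lemmas meet_ac = meet_closed meet_assoc meet_comm meet_left_comm

lemma meet_idem: "x \<in> carrier A \<Longrightarrow> meet A x x = x"
  by (metis compl_closed join_compl join_zero meet_closed meet_compl meet_join_distrib meet_one)

lemma meet_left_idem:
  "\<lbrakk>x \<in> carrier A; y \<in> carrier A\<rbrakk> \<Longrightarrow> meet A x (meet A x y) = meet A x y"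
  by (metis meet_assoc meet_idem)

lemma meet_zero: "x \<in> carrier A \<Longrightarrow> meet A x (zero A) = zero A"
  by (metis compl_closed meet_compl meet_left_idem)

lemma meet_split:
  assumes "x \<in> carrier A" "y \<in> carrier A"
  shows "x = join A (meet A x y) (meet A x (compl A y))"
  using assms by (metis compl_closed join_compl meet_join_distrib meet_one)

text \<open>
  Zorn's lemma is applied to the meet-closed sets without \<open>zero A\<close>, and not to filters:
  a maximal such set is automatically upward closed and decides every element.
\<close>

lemma ultrafilter_lemma:
  assumes Z: "Z \<subseteq> carrier A" "one A \<in> Z" "zero A \<notin> Z"
    and meetZ: "\<And>x y. x \<in> Z \<Longrightarrow> y \<in> Z \<Longrightarrow> meet A x y \<in> Z"
  obtains u where "u \<in> canonical_points A" "Z \<subseteq> u"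
proof -
  define \<A> where "\<A> = {F. Z \<subseteq> F \<and> F \<subseteq> carrier A \<and> zero A \<notin> F \<and>
    (\<forall>x\<in>F. \<forall>y\<in>F. meet A x y \<in> F)}"
  have "\<exists>F\<in>\<A>. \<forall>X\<in>\<A>. F \<subseteq> X \<longrightarrow> X = F"
  proof (rule subset_Zorn_nonempty)
    show "\<A> \<noteq> {}" using assms by (auto simp: \<A>_def)
  next
    fix C assume C: "C \<noteq> {}" "subset.chain \<A> C"
    have sub: "C \<subseteq> \<A>" and ch: "\<And>X Y. X \<in> C \<Longrightarrow> Y \<in> C \<Longrightarrow> X \<subseteq> Y \<or> Y \<subseteq> X"
      using C(2) by (auto simp: subset_chain_def)
    have "meet A x y \<in> \<Union>C" if xy: "x \<in> \<Union>C" "y \<in> \<Union>C" for x y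
    proof -
      obtain X Y where X: "X \<in> C" "x \<in> X" "Y \<in> C" "y \<in> Y" using xy by blast
      obtain W where "W \<in> C" "x \<in> W" "y \<in> W" using ch[of X Y] X by blast
      then show ?thesis using sub by (auto simp: \<A>_def)
    qed
    then show "\<Union>C \<in> \<A>" using C(1) sub unfolding \<A>_def by blast
  qed
  then obtain F where F: "F \<in> \<A>" and max: "\<And>X. X \<in> \<A> \<Longrightarrow> F \<subseteq> X \<Longrightarrow> X = F" by blast
  have FZ: "Z \<subseteq> F" and Fc: "F \<subseteq> carrier A" and F0: "zero A \<notin> F"
    and Fm: "\<And>x y. x \<in> F \<Longrightarrow> y \<in> F \<Longrightarrow> meet A x y \<in> F"
    using F by (auto simp: \<A>_def)
  have F1: "one A \<in> F" using FZ Z by blast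
  have out: "\<exists>f\<in>F. meet A x f = zero A" if x: "x \<in> carrier A" "x \<notin> F" for x
  proof (rule ccontr)
    assume no: "\<not> (\<exists>f\<in>F. meet A x f = zero A)"
    let ?X = "F \<union> meet A x ` F"
    have "meet A a b \<in> ?X" if ab: "a \<in> ?X" "b \<in> ?X" for a b
    proof -
      have mixed: "meet A f (meet A x g) \<in> ?X" if "f \<in> F" "g \<in> F" for f g
      proof -
        have "meet A f (meet A x g) = meet A x (meet A f g)"
          using that Fc x by (intro meet_left_comm) auto
        then show ?thesis using Fm[OF that] by blast
      qed
      have both: "meet A (meet A x f) (meet A x g) \<in> ?X" if "f \<in> F" "g \<in> F" for f g
      proof -
        have c: "f \<in> carrier A" "g \<in> carrier A" using that Fc by auto
        have "meet A (meet A x f) (meet A x g) = meet A x (meet A f g)"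
          using c x by (simp add: meet_ac meet_idem meet_left_idem)
        then show ?thesis using Fm[OF that] by blast
      qed
      have mixed': "meet A (meet A x g) f \<in> ?X" if "f \<in> F" "g \<in> F" for f g
      proof -
        have "meet A (meet A x g) f = meet A f (meet A x g)"
          using that Fc x by (intro meet_comm meet_closed) auto
        then show ?thesis using mixed[OF that] by simp
      qed
      consider "a \<in> F" "b \<in> F" | g where "a \<in> F" "b = meet A x g" "g \<in> F"
        | f where "a = meet A x f" "f \<in> F" "b \<in> F"
        | f g where "a = meet A x f" "f \<in> F" "b = meet A x g" "g \<in> F"
        using ab by blast
      then show ?thesis by cases (metis mixed mixed' both Fm UnI1)+
    qed
    moreover have "?X \<subseteq> carrier A" using Fc x meet_closed by auto
    moreover have "zero A \<notin> ?X" using no F0 by force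
    ultimately have "?X \<in> \<A>" using FZ by (auto simp: \<A>_def)
    then have "?X = F" using max by blast
    moreover have "meet A x (one A) = x" using x meet_one by blast
    ultimately show False using F1 x(2) by force
  qed
  have alt: "x \<in> F \<or> compl A x \<in> F" if x: "x \<in> carrier A" for x
  proof (rule ccontr)
    assume "\<not> ?thesis"
    then obtain f g where fg: "f \<in> F" "g \<in> F"
      "meet A x f = zero A" "meet A (compl A x) g = zero A"
      using out[of x] out[of "compl A x"] x compl_closed by blast
    have c: "f \<in> carrier A" "g \<in> carrier A" "compl A x \<in> carrier A"
      using fg Fc x compl_closed by auto
    have "meet A (meet A f g) x = meet A g (meet A x f)"
      using c x by (simp add: meet_ac)
    moreover have "meet A (meet A f g) (compl A x) = meet A f (meet A (compl A x) g)"
      using c x by (simp add: meet_ac)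
    ultimately have "meet A f g = join A (zero A) (zero A)"
      using meet_split[of "meet A f g" x] c x fg meet_zero meet_closed by metis
    then have "meet A f g = zero A" using join_zero zero_closed by metis
    then show False using Fm[OF fg(1,2)] F0 by simp
  qed
  have up: "y \<in> F" if "x \<in> F" "y \<in> carrier A" "meet A x y = x" for x y
  proof (rule ccontr)
    assume "y \<notin> F"
    then have *: "meet A x (compl A y) \<in> F" using alt that Fm by blast
    have x: "x \<in> carrier A" using that Fc by blast
    have "meet A x (compl A y) = meet A x (meet A y (compl A y))"
      using that x by (metis compl_closed meet_assoc)
    then have "meet A x (compl A y) = zero A"
      using that x meet_compl meet_zero by metis
    then show False using * F0 by simp
  qed
  have "ultrafilter_of A F"
    unfolding ultrafilter_of_def using Fc F1 F0 Fm up alt by blast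
  then show ?thesis using that FZ by (simp add: canonical_points_def)
qed

context
  fixes u assumes u: "u \<in> canonical_points A"
begin

lemma uf_carrier: "x \<in> u \<Longrightarrow> x \<in> carrier A"
  and uf_one: "one A \<in> u" and uf_zero: "zero A \<notin> u"
  and uf_meetI: "x \<in> u \<Longrightarrow> y \<in> u \<Longrightarrow> meet A x y \<in> u"
  and uf_up: "x \<in> u \<Longrightarrow> y \<in> carrier A \<Longrightarrow> meet A x y = x \<Longrightarrow> y \<in> u"
  and uf_alt: "x \<in> carrier A \<Longrightarrow> x \<in> u \<or> compl A x \<in> u"
  using u by (auto simp: canonical_points_def ultrafilter_of_def)

lemma uf_compl: "x \<in> carrier A \<Longrightarrow> compl A x \<in> u \<longleftrightarrow> x \<notin> u"
  using uf_alt uf_meetI uf_zero meet_compl by metis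

lemma uf_meet:
  assumes "x \<in> carrier A" "y \<in> carrier A"
  shows "meet A x y \<in> u \<longleftrightarrow> x \<in> u \<and> y \<in> u"
proof
  assume *: "meet A x y \<in> u"
  have "meet A (meet A x y) x = meet A x y" "meet A (meet A x y) y = meet A x y"
    using assms by (simp_all add: meet_ac meet_idem meet_left_idem)
  then show "x \<in> u \<and> y \<in> u" using uf_up[OF *] assms by blast
qed (simp add: uf_meetI)

lemma uf_join:
  assumes xy: "x \<in> carrier A" "y \<in> carrier A"
  shows "join A x y \<in> u \<longleftrightarrow> x \<in> u \<or> y \<in> u"
proof
  assume j: "join A x y \<in> u"
  show "x \<in> u \<or> y \<in> u"
  proof (rule ccontr)
    assume "\<not> ?thesis"
    then have c: "compl A x \<in> u" "compl A y \<in> u" using xy uf_alt by auto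
    have "meet A (compl A x) (join A x y) = join A (zero A) (meet A (compl A x) y)"
      using xy by (metis compl_closed meet_comm meet_compl meet_join_distrib)
    also have "\<dots> = meet A (compl A x) y"
      using xy by (metis compl_closed join_comm join_zero meet_closed zero_closed)
    finally have "meet A (compl A x) y \<in> u" using uf_meetI[OF c(1) j] by simp
    then show False using c(2) xy uf_meet uf_compl compl_closed by metis
  qed
next
  have absorb: "join A a b \<in> u" if a: "a \<in> u" and b: "b \<in> carrier A" for a b
  proof -
    have ac: "a \<in> carrier A" using uf_carrier[OF a] .
    have "meet A a (join A a b) = join A (meet A a (one A)) (meet A a b)"
      using ac b by (simp add: meet_join_distrib meet_idem meet_one)
    also have "\<dots> = meet A a (join A (one A) b)"
      using ac b by (simp add: meet_join_distrib one_closed)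
    also have "join A (one A) b = one A"
      using b by (metis compl_closed join_closed join_comm join_compl join_meet_distrib
          meet_comm meet_one one_closed)
    finally have "meet A a (join A a b) = a" using ac meet_one by simp
    then show ?thesis using uf_up[OF a] ac b join_closed by blast
  qed
  show "x \<in> u \<or> y \<in> u \<Longrightarrow> join A x y \<in> u"
    using absorb[of x y] absorb[of y x] xy join_comm by metis
qed

text \<open>
  Stands in for the meet of a finite subset of an ultrafilter, with no iterated operation: all that
  is ever used of the meet \<open>e\<close> is which ultrafilters contain it.
\<close>

lemma uf_finite_meet:
  assumes "finite Y" "Y \<subseteq> u"
  shows "\<exists>e\<in>u. \<forall>v\<in>canonical_points A. e \<in> v \<longrightarrow> Y \<subseteq> v"
  using assms
proof (induction Y)
  case empty
  then show ?case using uf_one by blast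
next
  case (insert y Y)
  then obtain e where e: "e \<in> u" "\<And>v. v \<in> canonical_points A \<Longrightarrow> e \<in> v \<Longrightarrow> Y \<subseteq> v" by auto
  have y: "y \<in> u" using insert by blast
  have "meet A y e \<in> u" using uf_meetI e y by blast
  moreover have "insert y Y \<subseteq> v" if v: "v \<in> canonical_points A" "meet A y e \<in> v" for v
  proof -
    have "y \<in> v \<and> e \<in> v"
      using boolean_alg.uf_meet[OF boolean_alg_axioms v(1)] v(2) uf_carrier e(1) y by blast
    then show ?thesis using e(2)[OF v(1)] by blast
  qed
  ultimately show ?case by blast
qed

end

lemma ex_ultrafilter:
  assumes "x \<in> carrier A" "x \<noteq> zero A"
  obtains u where "u \<in> canonical_points A" "x \<in> u"
proof (rule ultrafilter_lemma[of "{one A, x}"])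
  show "one A \<in> {one A, x}" by simp
  show "{one A, x} \<subseteq> carrier A" using assms one_closed by blast
  show "zero A \<notin> {one A, x}"
    using assms meet_one meet_zero by (metis empty_iff insert_iff)
  show "meet A a b \<in> {one A, x}" if "a \<in> {one A, x}" "b \<in> {one A, x}" for a b
    using that assms one_closed meet_one meet_comm meet_idem by (metis empty_iff insert_iff)
qed (use that in auto)

text \<open>
  The dual form of Stone's representation theorem: it turns the verification of an identity between
  elements into propositional reasoning about membership in ultrafilters.
\<close>

lemma stone_eqI:
  assumes xy: "x \<in> carrier A" "y \<in> carrier A"
    and eq: "\<And>u. u \<in> canonical_points A \<Longrightarrow> x \<in> u \<longleftrightarrow> y \<in> u"
  shows "x = y"
proof -
  have zero: "meet A a (compl A b) = zero A"
    if ab: "a \<in> carrier A" "b \<in> carrier A"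
      and "\<And>u. u \<in> canonical_points A \<Longrightarrow> a \<in> u \<Longrightarrow> b \<in> u" for a b
  proof (rule ccontr)
    assume "meet A a (compl A b) \<noteq> zero A"
    then obtain u where u: "u \<in> canonical_points A" "meet A a (compl A b) \<in> u"
      using ex_ultrafilter[of "meet A a (compl A b)"] ab meet_closed compl_closed by blast
    then show False using that uf_meet[OF u(1)] uf_compl[OF u(1)] compl_closed by metis
  qed
  have "x = meet A x y"
    using meet_split[OF xy] zero[of x y] eq xy join_zero meet_closed by metis
  also have "\<dots> = meet A y x" using xy by (rule meet_comm)
  also have "\<dots> = y"
    using meet_split[OF xy(2,1)] zero[of y x] eq xy join_zero meet_closed by metis
  finally show ?thesis .
qed

text \<open>
  The filter generated by \<open>K\<close> is described from the dual side, as the elements that are forced by a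
  finite part of \<open>K\<close>; this makes its closure under meets and its properness immediate.
\<close>

lemma compactness:
  assumes K: "K \<subseteq> carrier A"
    and fin: "\<And>K0. finite K0 \<Longrightarrow> K0 \<subseteq> K \<Longrightarrow> \<exists>u\<in>canonical_points A. K0 \<subseteq> u"
  obtains u where "u \<in> canonical_points A" "K \<subseteq> u"
proof -
  define Z where "Z = {e \<in> carrier A. \<exists>K0. finite K0 \<and> K0 \<subseteq> K \<and>
    (\<forall>u\<in>canonical_points A. K0 \<subseteq> u \<longrightarrow> e \<in> u)}"
  have KZ: "K \<subseteq> Z"
  proof
    fix k assume "k \<in> K"
    then show "k \<in> Z" unfolding Z_def using K by (auto intro!: exI[of _ "{k}"])
  qed
  show ?thesis
  proof (rule ultrafilter_lemma[of Z])
    show "Z \<subseteq> carrier A" by (auto simp: Z_def)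
    show "one A \<in> Z" by (auto simp: Z_def one_closed uf_one)
    show "zero A \<notin> Z" using fin uf_zero by (fastforce simp: Z_def)
    fix x y assume "x \<in> Z" "y \<in> Z"
    then obtain K1 K2 where c: "x \<in> carrier A" "y \<in> carrier A"
      and K1: "finite K1" "K1 \<subseteq> K" "\<forall>u\<in>canonical_points A. K1 \<subseteq> u \<longrightarrow> x \<in> u"
      and K2: "finite K2" "K2 \<subseteq> K" "\<forall>u\<in>canonical_points A. K2 \<subseteq> u \<longrightarrow> y \<in> u"
      unfolding Z_def by blast
    then show "meet A x y \<in> Z"
      unfolding Z_def using meet_closed uf_meetI
      by (auto intro!: exI[of _ "K1 \<union> K2"])
  qed (use that KZ in blast)
qed

end

section \<open>The canonical relation\<close>

lemma canonical_relD: "canonical_rel A u v \<Longrightarrow> a \<in> v \<Longrightarrow> dia A a \<in> u"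
  by (simp add: canonical_rel_def)

context dia_bao
begin

lemma dia_mono:
  assumes xy: "x \<in> carrier A" "y \<in> carrier A"
    and le: "\<And>u. u \<in> canonical_points A \<Longrightarrow> x \<in> u \<Longrightarrow> y \<in> u"
    and u: "u \<in> canonical_points A" "dia A x \<in> u"
  shows "dia A y \<in> u"
proof -
  have "join A x y = y"
    by (rule stone_eqI) (use xy le uf_join join_closed in auto)
  then have "dia A y = join A (dia A x) (dia A y)" using dia_join[OF xy] by simp
  then show ?thesis using uf_join[OF u(1)] u(2) xy dia_closed by metis
qed

text \<open>
  The elements \<open>e\<close> such that \<open>w\<close> does not consider a point with \<open>a\<close> and without \<open>e\<close> possible form a
  proper filter, and any ultrafilter that extends it is seen from \<open>w\<close>.
\<close>

lemma dia_witness: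
  assumes w: "w \<in> canonical_points A" and a: "a \<in> carrier A" "dia A a \<in> w"
  obtains u where "u \<in> canonical_points A" "canonical_rel A w u" "a \<in> u"
proof -
  define Z where "Z = {e \<in> carrier A. dia A (meet A a (compl A e)) \<notin> w}"
  have incl: "x \<in> Z" if "x \<in> carrier A" "y \<in> carrier A" "dia A y \<notin> w"
    "\<And>u. u \<in> canonical_points A \<Longrightarrow> a \<in> u \<Longrightarrow> x \<in> u \<or> y \<in> u" for x y
    unfolding Z_def
    using that dia_mono[of "meet A a (compl A x)" y w] a w
    by (auto simp: uf_meet uf_compl meet_closed compl_closed)
  have d0: "dia A (zero A) \<notin> w" using w by (simp add: dia_zero uf_zero)
  show ?thesis
  proof (rule ultrafilter_lemma[of Z])
    show "Z \<subseteq> carrier A" by (auto simp: Z_def)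
    show "one A \<in> Z" by (rule incl[of _ "zero A"]) (auto simp: one_closed zero_closed d0 uf_one)
    have "meet A a (compl A (zero A)) = a"
      by (rule stone_eqI) (auto simp: a meet_closed compl_closed zero_closed uf_meet uf_compl uf_zero)
    then show "zero A \<notin> Z" using a by (simp add: Z_def)
    fix x y assume xy: "x \<in> Z" "y \<in> Z"
    then have c: "x \<in> carrier A" "y \<in> carrier A" by (auto simp: Z_def)
    let ?y = "join A (meet A a (compl A x)) (meet A a (compl A y))"
    show "meet A x y \<in> Z"
    proof (rule incl[of _ ?y])
      show "dia A ?y \<notin> w"
        using xy c a w by (simp add: Z_def dia_join meet_closed compl_closed uf_join dia_closed)
    qed (use c a in \<open>auto simp: meet_closed join_closed compl_closed uf_join uf_meet uf_compl\<close>)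
  next
    fix u assume u: "u \<in> canonical_points A" "Z \<subseteq> u"
    have "a \<in> Z" by (rule incl[of _ "zero A"]) (auto simp: zero_closed d0 a)
    moreover have "dia A b \<in> w" if b: "b \<in> u" for b
    proof (rule ccontr)
      assume "dia A b \<notin> w"
      have bc: "b \<in> carrier A" using uf_carrier[OF u(1) b] .
      then have "compl A b \<in> Z"
        by (intro incl[of _ b]) (auto simp: compl_closed \<open>dia A b \<notin> w\<close> uf_compl)
      then show False using u b bc uf_compl by blast
    qed
    ultimately show ?thesis using that u by (auto simp: canonical_rel_def)
  qed
qed

lemma dia_in_uf_iff:
  assumes "w \<in> canonical_points A" "a \<in> carrier A"
  shows "dia A a \<in> w \<longleftrightarrow> (\<exists>u\<in>canonical_points A. canonical_rel A w u \<and> a \<in> u)"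
  using assms dia_witness canonical_relD by metis

text \<open>
  The points that \<open>w\<close> sees and that see every point of \<open>S\<close>. These sets, for finite \<open>S\<close>, are what a
  countable subalgebra has to reflect. They are closed in the Stone topology, since \<open>cone_theory w S\<close>
  axiomatises them.
\<close>

definition cone_below :: "'a set \<Rightarrow> 'a set set \<Rightarrow> 'a set set" where
  "cone_below w S = {u \<in> canonical_points A. canonical_rel A w u \<and> (\<forall>s\<in>S. canonical_rel A u s)}"

definition cone_theory :: "'a set \<Rightarrow> 'a set set \<Rightarrow> 'a set" where
  "cone_theory w S = {compl A c | c. c \<in> carrier A \<and> dia A c \<notin> w} \<union> (\<Union>s\<in>S. dia A ` s)"

lemma cone_below_iff:
  assumes S: "S \<subseteq> canonical_points A"
  shows "u \<in> cone_below w S \<longleftrightarrow> u \<in> canonical_points A \<and> cone_theory w S \<subseteq> u"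
proof (cases "u \<in> canonical_points A")
  case True
  have "canonical_rel A w u \<longleftrightarrow> (\<forall>c\<in>carrier A. dia A c \<notin> w \<longrightarrow> compl A c \<in> u)"
    using True uf_compl uf_carrier unfolding canonical_rel_def by metis
  then show ?thesis
    using True unfolding cone_below_def cone_theory_def
    by (simp add: UN_subset_iff image_subset_iff canonical_rel_def) blast
qed (auto simp: cone_below_def)

lemma cone_theory_carrier: "S \<subseteq> canonical_points A \<Longrightarrow> cone_theory w S \<subseteq> carrier A"
  using compl_closed dia_closed uf_carrier by (fastforce simp: cone_theory_def)

lemma cone_below_closed:
  assumes S: "S \<subseteq> canonical_points A" and Z: "Z \<subseteq> carrier A"
    and fin: "\<And>Y. finite Y \<Longrightarrow> Y \<subseteq> Z \<Longrightarrow> \<exists>u\<in>cone_below w S. Y \<subseteq> u"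
  obtains u where "u \<in> cone_below w S" "Z \<subseteq> u"
proof (rule compactness[of "cone_theory w S \<union> Z"])
  show "cone_theory w S \<union> Z \<subseteq> carrier A" using cone_theory_carrier S Z by blast
  fix K assume K: "finite K" "K \<subseteq> cone_theory w S \<union> Z"
  then obtain u where "u \<in> cone_below w S" "K \<inter> Z \<subseteq> u" using fin[of "K \<inter> Z"] by blast
  then show "\<exists>u\<in>canonical_points A. K \<subseteq> u" using cone_below_iff[OF S] K(2) by blast
qed (use that cone_below_iff[OF S] in blast)

text \<open>
  If no point of the closed set \<open>cone_below w S\<close> lies in the clopen set given by \<open>b\<close>, then by
  compactness finitely many elements \<open>D\<close> are responsible. A subalgebra that contains \<open>D\<close> therefore
  knows that \<open>b\<close> excludes \<open>cone_below w S\<close>.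
\<close>

lemma cone_below_empty_finite:
  assumes S: "S \<subseteq> canonical_points A" and b: "b \<in> carrier A"
    and empty: "\<And>u. u \<in> cone_below w S \<Longrightarrow> b \<notin> u"
  obtains D where "finite D" "D \<subseteq> carrier A"
    "\<And>u. u \<in> canonical_points A \<Longrightarrow> canonical_rel A w u \<Longrightarrow> b \<in> u \<Longrightarrow> \<exists>s\<in>S. \<exists>d\<in>D \<inter> s. dia A d \<notin> u"
proof -
  have "\<exists>K. finite K \<and> K \<subseteq> cone_theory w S \<union> {b} \<and> (\<forall>u\<in>canonical_points A. \<not> K \<subseteq> u)"
  proof (rule ccontr)
    assume *: "\<not> ?thesis"
    show False
      by (rule compactness[of "cone_theory w S \<union> {b}"])
        (use * cone_theory_carrier[OF S] b empty cone_below_iff[OF S] in auto)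
  qed
  then obtain K where K: "finite K" "K \<subseteq> cone_theory w S \<union> {b}"
    "\<And>u. u \<in> canonical_points A \<Longrightarrow> \<not> K \<subseteq> u" by blast
  let ?I = "\<lambda>d. \<exists>s\<in>S. d \<in> s"
  have "K \<inter> dia A ` {d. ?I d} \<subseteq> dia A ` {d. ?I d}" by blast
  then obtain D where D: "finite D" "D \<subseteq> {d. ?I d}" "K \<inter> dia A ` {d. ?I d} = dia A ` D"
    using finite_subset_image[of "K \<inter> dia A ` {d. ?I d}" "dia A" "{d. ?I d}"] K(1) by auto
  show ?thesis
  proof (rule that[of D])
    show "D \<subseteq> carrier A" using D(2) S uf_carrier by blast
    fix u assume u: "u \<in> canonical_points A" "canonical_rel A w u" "b \<in> u"
    obtain k where k: "k \<in> K" "k \<notin> u" using K(3)[OF u(1)] by blast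
    have "k \<noteq> b" using k u by blast
    moreover have "compl A c \<in> u" if "c \<in> carrier A" "dia A c \<notin> w" for c
      using that u uf_compl canonical_relD by metis
    ultimately have "k \<in> dia A ` {d. ?I d}"
      using k K(2) unfolding cone_theory_def by blast
    then have "k \<in> dia A ` D" using D(3) k(1) by blast
    then show "\<exists>s\<in>S. \<exists>d\<in>D \<inter> s. dia A d \<notin> u" using D(2) k(2) by blast
  qed (rule D(1))
qed

end

section \<open>Transitivity and finite antichains\<close>

definition validates :: "'a bao \<Rightarrow> fm \<Rightarrow> bool" where
  "validates A p \<longleftrightarrow> (\<forall>v. (\<forall>i. v i \<in> carrier A) \<longrightarrow> term_val A v p = one A)"

context dia_bao
begin

lemma term_closed: "(\<And>i. v i \<in> carrier A) \<Longrightarrow> term_val A v p \<in> carrier A"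
  by (induction p) (auto intro: one_closed join_closed compl_closed dia_closed)

context
  fixes v :: "nat \<Rightarrow> 'a" and u assumes v: "\<And>i. v i \<in> carrier A" and u: "u \<in> canonical_points A"
begin

lemma term_Neg: "term_val A v (Neg p) \<in> u \<longleftrightarrow> term_val A v p \<notin> u"
  and term_Or: "term_val A v (Or p q) \<in> u \<longleftrightarrow> term_val A v p \<in> u \<or> term_val A v q \<in> u"
  using term_closed[OF v] u by (simp_all add: uf_compl uf_join)

lemma term_Top: "term_val A v Top \<in> u"
  using u by (simp add: uf_one)

lemma term_And: "term_val A v (And p q) \<in> u \<longleftrightarrow> term_val A v p \<in> u \<and> term_val A v q \<in> u"
  and term_Imp: "term_val A v (Imp p q) \<in> u \<longleftrightarrow> (term_val A v p \<in> u \<longrightarrow> term_val A v q \<in> u)"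
  unfolding And_def Imp_def term_Neg term_Or by blast+

lemma term_Dia: "term_val A v (Dia p) \<in> u \<longleftrightarrow>
    (\<exists>u'\<in>canonical_points A. canonical_rel A u u' \<and> term_val A v p \<in> u')"
  using dia_in_uf_iff[OF u term_closed[OF v]] by simp

lemma term_Conj_list: "term_val A v (Conj_list ps) \<in> u \<longleftrightarrow> (\<forall>p\<in>set ps. term_val A v p \<in> u)"
  by (induction ps) (simp_all add: Conj_list_def term_And term_Top del: term_val.simps)

lemma term_Disj_list: "term_val A v (Disj_list ps) \<in> u \<longleftrightarrow> (\<exists>p\<in>set ps. term_val A v p \<in> u)"
  by (induction ps)
    (simp_all add: Disj_list_def Bot_def term_Or term_Neg term_Top del: term_val.simps)

end

lemma canonical_rel_trans:
  assumes four: "validates A Four_axiom"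
  shows "transp_on (canonical_points A) (canonical_rel A)"
proof (rule transp_onI, unfold canonical_rel_def, rule ballI)
  fix x y z a
  assume pts: "x \<in> canonical_points A" "y \<in> canonical_points A" "z \<in> canonical_points A"
    and rel: "\<forall>a\<in>y. dia A a \<in> x" "\<forall>a\<in>z. dia A a \<in> y" and a: "a \<in> z"
  define v :: "nat \<Rightarrow> 'a" where "v i = a" for i
  have v: "v i \<in> carrier A" for i using uf_carrier[OF pts(3) a] by (simp add: v_def)
  have "term_val A v Four_axiom \<in> x" using four v uf_one[OF pts(1)] by (simp add: validates_def)
  moreover have "dia A (dia A a) \<in> x" using a rel by blast
  ultimately show "dia A a \<in> x"
    unfolding Four_axiom_def term_Imp[OF v pts(1)] by (simp add: v_def)
qed

text \<open>
  An antichain of \<open>n + 1\<close> points seen from \<open>w\<close> would refute \<open>I_axiom n\<close> in the algebra itself.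
  Every point \<open>h i\<close> has a clopen neighbourhood \<open>q i\<close> that separates it from the others so well
  that \<open>q i\<close> and \<open>q j\<close> are disjoint and no point of \<open>q i\<close> sees a point of \<open>q j\<close>. With the \<open>q i\<close> as
  values of the atoms, the premise of \<open>I_axiom n\<close> holds at \<open>w\<close> and its conclusion fails.
\<close>

lemma antichain_card:
  assumes ax: "validates A (I_axiom n)"
    and w: "w \<in> canonical_points A"
    and D: "D \<subseteq> cone_below w {}" "pairwise (\<lambda>x y. \<not> canonical_rel A x y) D"
  shows "finite D \<and> card D \<le> n"
proof (rule ccontr)
  assume "\<not> ?thesis"
  then obtain D' where D': "D' \<subseteq> D" "card D' = Suc n" "finite D'"
    by (metis infinite_arbitrarily_large not_less_eq_eq obtain_subset_with_card_n)
  obtain h where h: "bij_betw h {0..<Suc n} D'"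
    using ex_bij_betw_nat_finite[OF D'(3)] D'(2) by metis
  have hD: "h i \<in> canonical_points A" "canonical_rel A w (h i)" if "i \<le> n" for i
  proof -
    have "i \<in> {0..<Suc n}" using that by simp
    then have "h i \<in> D'" using h by (rule bij_betwE[rule_format, rotated])
    then show "h i \<in> canonical_points A" "canonical_rel A w (h i)"
      using D(1) D'(1) by (auto simp: cone_below_def)
  qed
  have dist: "h i \<noteq> h j \<and> \<not> canonical_rel A (h i) (h j)" if "i \<le> n" "j \<le> n" "i \<noteq> j" for i j
  proof -
    have "h i \<in> D" "h j \<in> D" "h i \<noteq> h j"
      using that bij_betwE[OF h] bij_betw_imp_inj_on[OF h] D'(1)
      by (auto simp: inj_on_eq_iff simp del: atLeastLessThan_iff) (auto simp: inj_on_def)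
    then show ?thesis using D(2) by (simp add: pairwise_def)
  qed
  have "\<exists>c. c \<in> h i \<and> c \<notin> h j" if "i \<le> n" "j \<le> n" "i \<noteq> j" for i j
  proof (rule ccontr)
    assume "\<not> ?thesis"
    then have "h i \<subseteq> h j" by blast
    moreover have "h j \<subseteq> h i"
      using \<open>h i \<subseteq> h j\<close> hD that uf_alt uf_compl uf_carrier by (metis subset_iff)
    ultimately show False using dist that by blast
  qed
  then obtain c where c: "\<And>i j. i \<le> n \<Longrightarrow> j \<le> n \<Longrightarrow> i \<noteq> j \<Longrightarrow> c i j \<in> h i \<and> c i j \<notin> h j"
    by metis
  obtain d where d: "\<And>i j. i \<le> n \<Longrightarrow> j \<le> n \<Longrightarrow> i \<noteq> j \<Longrightarrow> d i j \<in> h j \<and> dia A (d i j) \<notin> h i"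
    using dist unfolding canonical_rel_def by metis
  \<comment> \<open>The elements of \<open>Q i\<close> hold at \<open>h i\<close>: \<open>c\<close> makes the neighbourhoods of \<open>h i\<close> and \<open>h j\<close> disjoint,
    and \<open>d\<close> prevents the points of one from seeing those of the other.\<close>
  define Q where "Q i = (\<Union>j\<in>{0..n} - {i}.
    {c i j, compl A (c j i), d j i, compl A (dia A (d i j))})" for i
  have Qmem: "{c i j, compl A (c j i), d j i, compl A (dia A (d i j))} \<subseteq> Q i"
    if "j \<le> n" "j \<noteq> i" for i j using that unfolding Q_def by auto
  have Qh: "Q i \<subseteq> h i" if "i \<le> n" for i
  proof -
    have "{c i j, compl A (c j i), d j i, compl A (dia A (d i j))} \<subseteq> h i"
      if "j \<in> {0..n} - {i}" for j
    proof -
      have j: "j \<le> n" "j \<noteq> i" using that by auto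
      have "compl A (c j i) \<in> h i \<and> compl A (dia A (d i j)) \<in> h i"
        using c[of j i] d[of i j] \<open>i \<le> n\<close> j hD uf_carrier uf_compl dia_closed by metis
      then show ?thesis using c[of i j] d[of j i] \<open>i \<le> n\<close> j by blast
    qed
    then show ?thesis unfolding Q_def by blast
  qed
  have "\<exists>e\<in>h i. \<forall>u\<in>canonical_points A. e \<in> u \<longrightarrow> Q i \<subseteq> u" if "i \<le> n" for i
    by (rule uf_finite_meet[OF hD(1)[OF that] _ Qh[OF that]]) (simp add: Q_def)
  then obtain q where q: "\<And>i. i \<le> n \<Longrightarrow> q i \<in> h i"
    "\<And>i u. i \<le> n \<Longrightarrow> u \<in> canonical_points A \<Longrightarrow> q i \<in> u \<Longrightarrow> Q i \<subseteq> u"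
    by metis
  define v where "v i = (if i \<le> n then q i else one A)" for i
  have v: "v i \<in> carrier A" for i
    using q(1) hD(1) uf_carrier one_closed by (auto simp: v_def)
  have vq: "term_val A v (Atom i) = q i" if "i \<le> n" for i using that by (simp add: v_def)
  have "term_val A v (I_axiom n) \<in> w" using ax v uf_one[OF w] by (simp add: validates_def)
  moreover have "term_val A v (Conj_list [Dia (Atom i). i \<leftarrow> [0..<Suc n]]) \<in> w"
    unfolding term_Conj_list[OF v w]
  proof
    fix p assume "p \<in> set [Dia (Atom i). i \<leftarrow> [0..<Suc n]]"
    then obtain i where i: "i \<le> n" "p = Dia (Atom i)" by auto
    then show "term_val A v p \<in> w"
      using q(1)[of i] hD(2)[of i] canonical_relD by (fastforce simp: v_def)
  qed
  ultimately have "term_val A v (Disj_list [Dia (And (Atom i) (Or (Atom j) (Dia (Atom j)))).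
      i \<leftarrow> [0..<Suc n], j \<leftarrow> [0..<Suc n], i \<noteq> j]) \<in> w"
    unfolding I_axiom_def term_Imp[OF v w] by blast
  then obtain i j where ij: "i \<le> n" "j \<le> n" "i \<noteq> j"
    and "term_val A v (Dia (And (Atom i) (Or (Atom j) (Dia (Atom j))))) \<in> w"
    unfolding term_Disj_list[OF v w] by (auto simp: less_Suc_eq_le simp del: upt_Suc term_val.simps)
  then obtain u where u: "u \<in> canonical_points A"
    and "term_val A v (And (Atom i) (Or (Atom j) (Dia (Atom j)))) \<in> u"
    unfolding term_Dia[OF v w] by blast
  then have qi: "q i \<in> u" and "q j \<in> u \<or> term_val A v (Dia (Atom j)) \<in> u"
    unfolding term_And[OF v u] term_Or[OF v u] vq[OF ij(1)] vq[OF ij(2)] by blast+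
  then show False
  proof (elim disjE)
    assume "q j \<in> u"
    then have "compl A (c i j) \<in> u" using q(2)[OF ij(2) u] Qmem[OF ij(1,3)] by blast
    moreover have "c i j \<in> u" using q(2)[OF ij(1) u qi] Qmem[OF ij(2) ij(3)[symmetric]] by blast
    ultimately show False using uf_compl[OF u uf_carrier[OF u]] by blast
  next
    assume "term_val A v (Dia (Atom j)) \<in> u"
    then obtain u' where u': "u' \<in> canonical_points A" "canonical_rel A u u'" "q j \<in> u'"
      unfolding term_Dia[OF v u] vq[OF ij(2)] by blast
    have "d i j \<in> u'" using q(2)[OF ij(2) u'(1,3)] Qmem[OF ij(1,3)] by blast
    then have "dia A (d i j) \<in> u" by (rule canonical_relD[OF u'(2)])
    moreover have "compl A (dia A (d i j)) \<in> u"
      using q(2)[OF ij(1) u qi] Qmem[OF ij(2) ij(3)[symmetric]] by blast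
    ultimately show False using uf_compl[OF u uf_carrier[OF u]] by blast
  qed
qed

end

section \<open>Maximal points and finite width\<close>

context dia_bao
begin

text \<open>
  The Stone topology supplies upper bounds: along a chain \<open>C\<close> without a greatest element, the
  clopen sets that eventually contain the points of \<open>C\<close> have a common point in the closed set
  \<open>cone_below w S\<close>, and every point of \<open>C\<close> sees it. The relation need not be antisymmetric, so
  Zorn's lemma is applied to chains, ordered by inclusion, instead of points.
\<close>

lemma ex_maximal_in_cone_below:
  assumes trans: "transp_on (canonical_points A) (canonical_rel A)"
    and S: "S \<subseteq> canonical_points A" and x: "x \<in> cone_below w S"
  obtains m where "m \<in> cone_below w S" "x = m \<or> canonical_rel A x m"
    "\<And>v. v \<in> cone_below w S \<Longrightarrow> canonical_rel A m v \<Longrightarrow> v = m \<or> canonical_rel A v m"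
proof -
  let ?X = "cone_below w S"
  have pts: "?X \<subseteq> canonical_points A" by (auto simp: cone_below_def)
  define le where "le u v \<longleftrightarrow> u = v \<or> canonical_rel A u v" for u v
  define \<A> where "\<A> = {C. x \<in> C \<and> C \<subseteq> ?X \<and> (\<forall>c\<in>C. \<forall>d\<in>C. le c d \<or> le d c)}"
  have "\<exists>C\<in>\<A>. \<forall>D\<in>\<A>. C \<subseteq> D \<longrightarrow> D = C"
  proof (rule subset_Zorn_nonempty)
    have "{x} \<in> \<A>" using x by (simp add: \<A>_def le_def)
    then show "\<A> \<noteq> {}" by blast
  next
    fix \<C> assume \<C>: "\<C> \<noteq> {}" "subset.chain \<A> \<C>"
    have sub: "\<C> \<subseteq> \<A>" and ch: "\<And>C D. C \<in> \<C> \<Longrightarrow> D \<in> \<C> \<Longrightarrow> C \<subseteq> D \<or> D \<subseteq> C"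
      using \<C>(2) by (auto simp: subset_chain_def)
    have "le c d \<or> le d c" if cd: "c \<in> \<Union>\<C>" "d \<in> \<Union>\<C>" for c d
    proof -
      obtain C D where "C \<in> \<C>" "c \<in> C" "D \<in> \<C>" "d \<in> D" using cd by blast
      then obtain E where "E \<in> \<C>" "c \<in> E" "d \<in> E" using ch by blast
      then show ?thesis using sub by (auto simp: \<A>_def)
    qed
    then show "\<Union>\<C> \<in> \<A>" using \<C>(1) sub unfolding \<A>_def by blast
  qed
  then obtain C where C: "C \<in> \<A>" and max: "\<And>D. D \<in> \<A> \<Longrightarrow> C \<subseteq> D \<Longrightarrow> D = C" by blast
  have xC: "x \<in> C" and CX: "C \<subseteq> ?X" and chain: "\<And>c d. c \<in> C \<Longrightarrow> d \<in> C \<Longrightarrow> le c d \<or> le d c"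
    using C by (auto simp: \<A>_def)
  have "\<exists>u\<in>?X. \<forall>c\<in>C. le c u"
  proof (cases "\<exists>u\<in>C. \<forall>c\<in>C. le c u")
    case True
    then show ?thesis using CX by blast
  next
    case False
    have next_C: "\<exists>d\<in>C. canonical_rel A c d" if "c \<in> C" for c
      using False chain that unfolding le_def by metis
    define Z where "Z = {b \<in> carrier A. \<exists>c\<in>C. \<forall>d\<in>C. canonical_rel A c d \<longrightarrow> b \<in> d}"
    have fin: "\<exists>c\<in>C. \<forall>d\<in>C. canonical_rel A c d \<longrightarrow> Y \<subseteq> d" if "finite Y" "Y \<subseteq> Z" for Y
      using that
    proof (induction Y)
      case empty
      then show ?case using xC by blast
    next
      case (insert y Y)
      then obtain c1 where c1: "c1 \<in> C" "\<And>d. d \<in> C \<Longrightarrow> canonical_rel A c1 d \<Longrightarrow> Y \<subseteq> d"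
        by auto
      have "y \<in> Z" using insert.prems by simp
      then obtain c2 where c2: "c2 \<in> C" "\<And>d. d \<in> C \<Longrightarrow> canonical_rel A c2 d \<Longrightarrow> y \<in> d"
        by (auto simp: Z_def)
      have step: "canonical_rel A c d" if "c \<in> C" "c' \<in> C" "d \<in> C" "le c c'" "canonical_rel A c' d"
        for c c' d
        using that transp_onD[OF trans, of c c' d] CX pts unfolding le_def by blast
      show ?case
      proof (cases "le c1 c2")
        case True
        then have "\<forall>d\<in>C. canonical_rel A c2 d \<longrightarrow> insert y Y \<subseteq> d"
          using c1 c2 step[of c1 c2] by auto
        then show ?thesis using c2(1) by blast
      next
        case False
        then have "le c2 c1" using chain c1(1) c2(1) by blast
        then have "\<forall>d\<in>C. canonical_rel A c1 d \<longrightarrow> insert y Y \<subseteq> d"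
          using c1 c2 step[of c2 c1] by auto
        then show ?thesis using c1(1) by blast
      qed
    qed
    have "\<exists>u\<in>?X. Y \<subseteq> u" if Y: "finite Y" "Y \<subseteq> Z" for Y
    proof -
      obtain c where c: "c \<in> C" "\<And>d. d \<in> C \<Longrightarrow> canonical_rel A c d \<Longrightarrow> Y \<subseteq> d"
        using fin[OF Y] by auto
      obtain d where "d \<in> C" "canonical_rel A c d" using next_C[OF c(1)] by auto
      then show ?thesis using c(2) CX by auto
    qed
    moreover have "Z \<subseteq> carrier A" by (auto simp: Z_def)
    ultimately obtain u where u: "u \<in> ?X" "Z \<subseteq> u"
      using cone_below_closed[OF S] by metis
    have "canonical_rel A c u" if c: "c \<in> C" for c
      unfolding canonical_rel_def
    proof (rule ballI, rule ccontr)
      fix b assume b: "b \<in> u" "dia A b \<notin> c"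
      have bc: "b \<in> carrier A" using u(1) pts b(1) uf_carrier by blast
      have "compl A b \<in> d" if "d \<in> C" "canonical_rel A c d" for d
      proof -
        have "b \<notin> d" using canonical_relD[OF that(2)] b(2) by blast
        then show ?thesis using that(1) CX pts uf_compl bc by blast
      qed
      then have "compl A b \<in> Z" using c bc compl_closed by (auto simp: Z_def)
      then show False using u pts b(1) bc uf_compl by blast
    qed
    then show ?thesis using u(1) by (auto simp: le_def)
  qed
  then obtain u where u: "u \<in> ?X" "\<And>c. c \<in> C \<Longrightarrow> le c u" by blast
  show ?thesis
  proof (rule that[of u])
    show "x = u \<or> canonical_rel A x u" using u(2)[OF xC] by (simp add: le_def)
    fix v assume v: "v \<in> ?X" "canonical_rel A u v"
    have "le c v" if "c \<in> C" for c
      using u(2)[OF that] transp_onD[OF trans, of c u v] that v u(1) CX pts unfolding le_def by blast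
    moreover have "le v v" by (simp add: le_def)
    ultimately have "insert v C \<in> \<A>" using C v(1) unfolding \<A>_def by blast
    then have "v \<in> C" using max by blast
    then show "v = u \<or> canonical_rel A v u" using u(2) by (simp add: le_def)
  qed (rule u(1))
qed

text \<open>
  This is the only use of finite width. Among the antichains of maximal points, take one of
  greatest cardinality: any further maximal point is comparable to a member, hence in its cluster.
\<close>

lemma finite_cofinal_in_cone_below:
  assumes trans: "transp_on (canonical_points A) (canonical_rel A)"
    and width: "\<forall>D \<subseteq> cone_below w {}. pairwise (\<lambda>x y. \<not> canonical_rel A x y) D
        \<longrightarrow> finite D \<and> card D \<le> n"
    and S: "S \<subseteq> canonical_points A"
  shows "\<exists>E. finite E \<and> E \<subseteq> cone_below w S \<and>
    (\<forall>x\<in>cone_below w S. \<exists>r\<in>E. x = r \<or> canonical_rel A x r)"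
proof -
  let ?X = "cone_below w S"
  have pts: "?X \<subseteq> canonical_points A" and cone: "?X \<subseteq> cone_below w {}"
    by (auto simp: cone_below_def)
  define Mx where "Mx = {m \<in> ?X. \<forall>v\<in>?X. canonical_rel A m v \<longrightarrow> v = m \<or> canonical_rel A v m}"
  define P where "P D \<longleftrightarrow> D \<subseteq> Mx \<and> pairwise (\<lambda>x y. \<not> canonical_rel A x y) D" for D
  have bound: "finite D \<and> card D \<le> n" if "P D" for D
  proof -
    have "D \<subseteq> cone_below w {}" using that cone by (auto simp: P_def Mx_def)
    then show ?thesis using width that unfolding P_def by blast
  qed
  have "P {}" by (simp add: P_def)
  moreover have "\<forall>D. P D \<longrightarrow> card D < Suc n" using bound le_imp_less_Suc by metis
  ultimately have "\<exists>D. P D \<and> (\<forall>D'. P D' \<longrightarrow> card D' \<le> card D)"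
    by (rule ex_has_greatest_nat)
  then obtain D where D: "P D" and max: "\<And>D'. P D' \<Longrightarrow> card D' \<le> card D" by auto
  have "\<exists>r\<in>D. x = r \<or> canonical_rel A x r" if x: "x \<in> ?X" for x
  proof -
    obtain m where m: "m \<in> ?X" "x = m \<or> canonical_rel A x m"
      "\<And>v. v \<in> ?X \<Longrightarrow> canonical_rel A m v \<Longrightarrow> v = m \<or> canonical_rel A v m"
      using ex_maximal_in_cone_below[OF trans S x] by blast
    show ?thesis
    proof (cases "m \<in> D")
      case False
      have mM: "m \<in> Mx" using m by (simp add: Mx_def)
      have "card (insert m D) = Suc (card D)" using False bound[OF D] by simp
      then have "\<not> P (insert m D)" using max[of "insert m D"] by auto
      then obtain d where d: "d \<in> D" "canonical_rel A m d \<or> canonical_rel A d m" "m \<noteq> d"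
        using mM D unfolding P_def pairwise_insert by blast
      have dM: "d \<in> Mx" using D d(1) by (auto simp: P_def)
      then have md: "canonical_rel A m d"
        using d(2,3) m(1) unfolding Mx_def by blast
      have "canonical_rel A x d"
        using m(2) md transp_onD[OF trans, of x m d] x m(1) dM pts unfolding Mx_def by blast
      then show ?thesis using d(1) by blast
    qed (use m(2) in blast)
  qed
  moreover have "D \<subseteq> ?X" using D by (auto simp: P_def Mx_def)
  ultimately show ?thesis using bound[OF D] by blast
qed

end

section \<open>Countable closure\<close>

text \<open>
  The downward Loewenheim-Skolem argument in a combinatorial form: \<open>G F\<close> collects the witnesses
  that are demanded by the finite set \<open>F\<close>.
\<close>

lemma countable_closure:
  assumes X0: "countable X0" "X0 \<subseteq> U"
    and G: "\<And>F. finite F \<Longrightarrow> F \<subseteq> U \<Longrightarrow> countable (G F) \<and> G F \<subseteq> U"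
  obtains X where "X0 \<subseteq> X" "X \<subseteq> U" "countable X" "\<And>F. finite F \<Longrightarrow> F \<subseteq> X \<Longrightarrow> G F \<subseteq> X"
proof -
  define step where "step X = X \<union> (\<Union>F\<in>{F. finite F \<and> F \<subseteq> X}. G F)" for X
  define C where "C k = (step ^^ k) X0" for k
  have C0: "C 0 = X0" and CS: "C (Suc k) = step (C k)" for k by (simp_all add: C_def)
  have C: "countable (C k) \<and> C k \<subseteq> U" for k
  proof (induction k)
    case 0
    then show ?case using X0 by (simp add: C0)
  next
    case (Suc k)
    have "countable {F. finite F \<and> F \<subseteq> C k}"
      using Suc by (intro countable_Collect_finite_subset) blast
    moreover have "countable (G F) \<and> G F \<subseteq> U" if "finite F \<and> F \<subseteq> C k" for F
      using G[of F] that Suc by blast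
    ultimately show ?case using Suc unfolding CS step_def
      by (auto intro!: countable_UN simp: UN_subset_iff)
  qed
  have mono: "C i \<subseteq> C j" if "i \<le> j" for i j
    using that by (rule lift_Suc_mono_le[rotated]) (auto simp: CS step_def)
  have fin: "\<exists>k. F \<subseteq> C k" if "finite F" "F \<subseteq> (\<Union>k. C k)" for F
    using that
  proof (induction F)
    case (insert x F)
    then obtain i j where "F \<subseteq> C i" "x \<in> C j" by auto
    then have "insert x F \<subseteq> C (max i j)" using mono[of i "max i j"] mono[of j "max i j"] by auto
    then show ?case by blast
  qed simp
  show ?thesis
  proof (rule that[of "\<Union>k. C k"])
    show "X0 \<subseteq> (\<Union>k. C k)" using C0 by blast
    show "(\<Union>k. C k) \<subseteq> U" "countable (\<Union>k. C k)" using C by auto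
    fix F assume F: "finite F" "F \<subseteq> (\<Union>k. C k)"
    then obtain k where "F \<subseteq> C k" using fin by blast
    then have "G F \<subseteq> C (Suc k)" using F(1) by (auto simp: CS step_def)
    then show "G F \<subseteq> (\<Union>k. C k)" by blast
  qed
qed

section \<open>Subalgebras\<close>

definition subalg :: "'a bao \<Rightarrow> 'a set \<Rightarrow> 'a bao" where
  "subalg A B = A\<lparr>carrier := B\<rparr>"

lemma subalg_sel [simp]:
  "carrier (subalg A B) = B" "zero (subalg A B) = zero A" "one (subalg A B) = one A"
  "join (subalg A B) = join A" "meet (subalg A B) = meet A"
  "compl (subalg A B) = compl A" "dia (subalg A B) = dia A"
  by (simp_all add: subalg_def)

lemma term_val_subalg [simp]: "term_val (subalg A B) v p = term_val A v p"
  by (induction p) simp_all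

lemma canonical_rel_subalg [simp]: "canonical_rel (subalg A B) = canonical_rel A"
  by (simp add: canonical_rel_def fun_eq_iff)

locale subuniverse = dia_bao A for A :: "'a bao" +
  fixes B :: "'a set"
  assumes sub: "B \<subseteq> carrier A"
    and sub_zero: "zero A \<in> B" and sub_one: "one A \<in> B"
    and sub_join: "x \<in> B \<Longrightarrow> y \<in> B \<Longrightarrow> join A x y \<in> B"
    and sub_meet: "x \<in> B \<Longrightarrow> y \<in> B \<Longrightarrow> meet A x y \<in> B"
    and sub_compl: "x \<in> B \<Longrightarrow> compl A x \<in> B"
    and sub_dia: "x \<in> B \<Longrightarrow> dia A x \<in> B"
begin

lemma dia_bao_subalg: "dia_bao (subalg A B)"
  by (unfold_locales; unfold subalg_sel;
      intro sub_zero sub_one sub_join sub_meet sub_compl sub_dia join_assoc meet_assoc join_comm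
        meet_comm meet_join_distrib join_meet_distrib join_zero meet_one join_compl meet_compl
        dia_zero dia_join subsetD[OF sub])

lemma restrict_point: "u \<in> canonical_points A \<Longrightarrow> u \<inter> B \<in> canonical_points (subalg A B)"
  using sub sub_one sub_meet sub_compl
  by (auto simp: canonical_points_def ultrafilter_of_def)

lemma restrict_rel: "canonical_rel A u v \<Longrightarrow> canonical_rel A (u \<inter> B) (v \<inter> B)"
  using sub_dia by (auto simp: canonical_rel_def)

lemma generated_subalg: "generated (subalg A B) B = B"
proof
  show "generated (subalg A B) B \<subseteq> B"
  proof
    fix x assume "x \<in> generated (subalg A B) B"
    then show "x \<in> B"
      by induction (simp_all add: sub_zero sub_one sub_join sub_meet sub_compl sub_dia)
  qed
qed (auto intro: gen_base)

text \<open>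
  Ultrafilters are maximal, so an ultrafilter that merely extends \<open>z\<close> restricts to it.
\<close>

lemma extend_eq:
  assumes "z \<in> canonical_points (subalg A B)" "u \<in> canonical_points A" "z \<subseteq> u"
  shows "z = u \<inter> B"
proof -
  interpret S: dia_bao "subalg A B" by (rule dia_bao_subalg)
  have "x \<in> z" if "x \<in> u" "x \<in> B" for x
  proof (rule ccontr)
    assume "x \<notin> z"
    then have "compl A x \<in> z" using S.uf_alt[OF assms(1), of x] that by simp
    then show False using assms(2,3) that sub uf_compl by blast
  qed
  moreover have "z \<subseteq> B" using S.uf_carrier[OF assms(1)] by auto
  ultimately show ?thesis using assms(3) by blast
qed

end

section \<open>Formulas in canonical extensions\<close>

abbreviation sat :: "'a bao \<Rightarrow> (nat \<Rightarrow> 'a set set) \<Rightarrow> fm \<Rightarrow> 'a set set" where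
  "sat A V \<equiv> term_val (canonical_extension A) V"

lemma sat_simps:
  "sat A V Top = canonical_points A"
  "sat A V (Neg p) = canonical_points A - sat A V p"
  "sat A V (Or p q) = sat A V p \<union> sat A V q"
  "sat A V (Dia p) = {u \<in> canonical_points A. \<exists>u'\<in>sat A V p. canonical_rel A u u'}"
  by (simp_all add: canonical_extension_def complex_algebra_def)

lemma sat_points: "(\<And>i. V i \<subseteq> canonical_points A) \<Longrightarrow> sat A V p \<subseteq> canonical_points A"
  by (induction p) (auto simp: sat_simps simp del: term_val.simps(2-5))

text \<open>
  A point can imitate another one as soon as they agree on the atoms and on the formulas
  \<open>Dia \<psi>\<close> with \<open>\<psi>\<close> in this finite set.
\<close>

primrec dia_args :: "fm \<Rightarrow> fm set" where
  "dia_args (Atom i) = {}"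
| "dia_args Top = {}"
| "dia_args (Neg p) = dia_args p"
| "dia_args (Or p q) = dia_args p \<union> dia_args q"
| "dia_args (Dia p) = insert p (dia_args p)"

lemma finite_dia_args: "finite (dia_args p)"
  by (induction p) simp_all

section \<open>Refutations over a reflecting subalgebra\<close>

text \<open>
  \<open>M\<close> and \<open>B\<close> play the roles of the points and the elements of an elementary substructure of the
  two-sorted structure of \<open>A\<close>, its canonical frame and the valuation \<open>V\<close>. Only the instances of
  elementarity that the argument needs are demanded; \<open>M_cofinal\<close> is the one that is incompatible
  with countability in general and is restored by finite width.
\<close>

locale reflection = subuniverse A B for A :: "'a bao" and B +
  fixes w :: "'a set" and M :: "'a set set" and V :: "nat \<Rightarrow> 'a set set" and \<Gamma> :: "fm set"
  assumes four: "validates A Four_axiom"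
    and w: "w \<in> M" and M: "M \<subseteq> canonical_points A"
    and fin: "finite \<Gamma>"
    and M_cofinal: "\<And>S x. \<lbrakk>finite S; S \<subseteq> M; x \<in> cone_below w S\<rbrakk>
        \<Longrightarrow> \<exists>r\<in>M \<inter> cone_below w S. x = r \<or> canonical_rel A x r"
    and M_witness: "\<And>m \<psi>. \<lbrakk>m \<in> M; \<psi> \<in> \<Gamma>; m \<in> sat A V (Dia \<psi>)\<rbrakk>
        \<Longrightarrow> \<exists>m'\<in>M \<inter> sat A V \<psi>. canonical_rel A m m'"
    and B_separates: "\<And>m m'. \<lbrakk>m \<in> M; m' \<in> M; m \<inter> B = m' \<inter> B\<rbrakk> \<Longrightarrow> m = m'"
    and B_reflects: "\<And>m m'. \<lbrakk>m \<in> M; m' \<in> M; canonical_rel A (m \<inter> B) (m' \<inter> B)\<rbrakk>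
        \<Longrightarrow> canonical_rel A m m'"
    and B_compact: "\<And>S b. \<lbrakk>finite S; S \<subseteq> M; b \<in> B; \<forall>u\<in>cone_below w S. b \<notin> u\<rbrakk>
        \<Longrightarrow> \<exists>D\<subseteq>B. finite D \<and> (\<forall>u\<in>canonical_points A. canonical_rel A w u \<longrightarrow> b \<in> u
              \<longrightarrow> (\<exists>s\<in>S. \<exists>d\<in>D \<inter> s. dia A d \<notin> u))"
begin

interpretation S: dia_bao "subalg A B" by (rule dia_bao_subalg)

lemma S_trans: "transp_on (canonical_points (subalg A B)) (canonical_rel A)"
  using S.canonical_rel_trans four sub by (simp add: validates_def subset_iff)

text \<open>
  By \<open>B_compact\<close>, every member of \<open>z\<close> is compatible with \<open>cone_below w S\<close>: otherwise
  finitely many elements of \<open>B\<close> would show that no point between \<open>w\<close> and \<open>S\<close> contains it, but in the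
  frame of the subalgebra \<open>z\<close> is such a point. Compactness then gives a single extension of \<open>z\<close>.
\<close>

lemma lift_point:
  assumes z: "z \<in> canonical_points (subalg A B)" "canonical_rel A (w \<inter> B) z"
    and S: "finite S" "S \<subseteq> M" "\<forall>s\<in>S. canonical_rel A z (s \<inter> B)"
  shows "\<exists>u\<in>cone_below w S. z = u \<inter> B"
proof -
  have zB: "z \<subseteq> B" using S.uf_carrier[OF z(1)] by auto
  have meets: "\<exists>e\<in>z. \<forall>u\<in>canonical_points A. e \<in> u \<longrightarrow> Y \<subseteq> u" if Y: "finite Y" "Y \<subseteq> z" for Y
  proof -
    obtain e where "e \<in> z" "\<And>v. v \<in> canonical_points (subalg A B) \<Longrightarrow> e \<in> v \<Longrightarrow> Y \<subseteq> v"
      using S.uf_finite_meet[OF z(1) Y] by blast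
    then show ?thesis using restrict_point zB by blast
  qed
  have "\<exists>u\<in>cone_below w S. Y \<subseteq> u" if Y: "finite Y" "Y \<subseteq> z" for Y
  proof -
    obtain e where e: "e \<in> z" "\<And>u. u \<in> canonical_points A \<Longrightarrow> e \<in> u \<Longrightarrow> Y \<subseteq> u"
      using meets[OF Y] by blast
    have "\<exists>u\<in>cone_below w S. e \<in> u"
    proof (rule ccontr)
      assume "\<not> ?thesis"
      then obtain D where D: "D \<subseteq> B" "finite D"
        "\<And>u. u \<in> canonical_points A \<Longrightarrow> canonical_rel A w u \<Longrightarrow> e \<in> u
            \<Longrightarrow> \<exists>s\<in>S. \<exists>d\<in>D \<inter> s. dia A d \<notin> u"
        using B_compact[OF S(1,2), of e] e(1) zB by blast
      define E where "E = insert e (dia A ` (D \<inter> \<Union>S))"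
      have "dia A d \<in> z" if "d \<in> D \<inter> \<Union>S" for d
        using that S(3) D(1) canonical_relD by fastforce
      then have "finite E" "E \<subseteq> z" using D(2) e(1) by (auto simp: E_def)
      from meets[OF this] obtain e'
        where e': "e' \<in> z" "\<And>u. u \<in> canonical_points A \<Longrightarrow> e' \<in> u \<Longrightarrow> E \<subseteq> u"
        by blast
      have "dia A e' \<in> w" using canonical_relD[OF z(2) e'(1)] by blast
      then obtain u where u: "u \<in> canonical_points A" "canonical_rel A w u" "e' \<in> u"
        using dia_witness[of w e'] w M e'(1) zB sub by blast
      have "E \<subseteq> u" using e'(2) u by blast
      then show False using D(3)[OF u(1,2)] by (auto simp: E_def)
    qed
    then obtain u where u: "u \<in> cone_below w S" "e \<in> u" by blast
    then have "Y \<subseteq> u" using e(2)[of u] by (simp add: cone_below_def)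
    then show ?thesis using u(1) by blast
  qed
  moreover have "z \<subseteq> carrier A" "S \<subseteq> canonical_points A" using zB sub S(2) M by auto
  ultimately obtain u where u: "u \<in> cone_below w S" "z \<subseteq> u"
    using cone_below_closed by metis
  then have "z = u \<inter> B" using extend_eq[OF z(1)] by (simp add: cone_below_def)
  then show ?thesis using u(1) by blast
qed

text \<open>
  The points of the frame of the subalgebra at which the new valuation has to be controlled.
\<close>

definition cone :: "'a set set" where
  "cone = {z \<in> canonical_points (subalg A B). z = w \<inter> B \<or> canonical_rel A (w \<inter> B) z}"

lemma dia_on_M:
  assumes m: "m \<in> M" and \<psi>: "\<psi> \<in> \<Gamma>"
  shows "m \<in> sat A V (Dia \<psi>) \<longleftrightarrow> (\<exists>m'\<in>M \<inter> sat A V \<psi>. canonical_rel A (m \<inter> B) (m' \<inter> B))"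
proof
  assume "m \<in> sat A V (Dia \<psi>)"
  then show "\<exists>m'\<in>M \<inter> sat A V \<psi>. canonical_rel A (m \<inter> B) (m' \<inter> B)"
    using M_witness[OF m \<psi>] restrict_rel by blast
next
  assume "\<exists>m'\<in>M \<inter> sat A V \<psi>. canonical_rel A (m \<inter> B) (m' \<inter> B)"
  then show "m \<in> sat A V (Dia \<psi>)"
    unfolding sat_simps using B_reflects m M by blast
qed

text \<open>
  This is the heart of the proof. A point \<open>z\<close> that comes from \<open>M\<close> imitates its origin. Any other
  \<open>z\<close> sees, for each \<open>\<psi>\<close> that is realised in \<open>M\<close> above \<open>z\<close>, some such realiser; collect one for
  each \<open>\<psi>\<close> in a finite set \<open>S\<close>. A lift of \<open>z\<close> to \<open>A\<close> lies in \<open>cone_below w S\<close> and thus equals or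
  sees a point \<open>r\<close> of \<open>M\<close> in the same set; equality would put \<open>z\<close> among the restrictions of \<open>M\<close>.
  So \<open>r\<close> lies between \<open>z\<close> and \<open>S\<close>: seeing \<open>S\<close>, it realises no fewer formulas \<open>Dia \<psi>\<close> than \<open>z\<close>
  should, and being seen by \<open>z\<close>, no more. That \<open>z\<close> sees the restriction of its imitation \<open>r\<close> is what
  keeps the truth lemma correct at the predecessors of \<open>z\<close>.
\<close>

lemma ex_imitation:
  assumes z: "z \<in> cone"
  shows "\<exists>m\<in>M. (z \<in> (\<lambda>m. m \<inter> B) ` M \<longrightarrow> z = m \<inter> B) \<and> (z = m \<inter> B \<or> canonical_rel A z (m \<inter> B)) \<and>
    (\<forall>\<psi>\<in>\<Gamma>. m \<in> sat A V (Dia \<psi>) \<longleftrightarrow> (\<exists>m'\<in>M \<inter> sat A V \<psi>. canonical_rel A z (m' \<inter> B)))"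
proof (cases "z \<in> (\<lambda>m. m \<inter> B) ` M")
  case True
  then show ?thesis using dia_on_M by blast
next
  case False
  then have wz: "canonical_rel A (w \<inter> B) z" and zp: "z \<in> canonical_points (subalg A B)"
    using z w by (auto simp: cone_def)
  define P where "P \<psi> m \<longleftrightarrow> m \<in> M \<inter> sat A V \<psi> \<and> canonical_rel A z (m \<inter> B)" for \<psi> m
  define T where "T = {\<psi> \<in> \<Gamma>. \<exists>m. P \<psi> m}"
  define S where "S = (\<lambda>\<psi>. SOME m. P \<psi> m) ` T"
  have choice: "P \<psi> (SOME m. P \<psi> m)" if "\<psi> \<in> T" for \<psi>
    using that unfolding T_def by (auto intro: someI_ex)
  have S: "finite S" "S \<subseteq> M" "\<forall>s\<in>S. canonical_rel A z (s \<inter> B)"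
    using fin choice by (auto simp: S_def P_def T_def)
  then obtain u where u: "u \<in> cone_below w S" "z = u \<inter> B" using lift_point[OF zp wz] by blast
  obtain r where r: "r \<in> M" "r \<in> cone_below w S" "u = r \<or> canonical_rel A u r"
    using M_cofinal[OF S(1,2) u(1)] by blast
  have zr: "canonical_rel A z (r \<inter> B)" using r(1,3) u(2) False restrict_rel by blast
  have "r \<in> sat A V (Dia \<psi>) \<longleftrightarrow> (\<exists>m. P \<psi> m)" if \<psi>: "\<psi> \<in> \<Gamma>" for \<psi>
  proof
    assume "r \<in> sat A V (Dia \<psi>)"
    then obtain m where m: "m \<in> M \<inter> sat A V \<psi>" "canonical_rel A (r \<inter> B) (m \<inter> B)"
      using dia_on_M[OF r(1) \<psi>] by blast
    have "canonical_rel A z (m \<inter> B)"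
      using transp_onD[OF S_trans zp _ _ zr m(2)] r(1) m(1) M restrict_point by blast
    then show "\<exists>m. P \<psi> m" using m(1) unfolding P_def by blast
  next
    assume "\<exists>m. P \<psi> m"
    then have "\<psi> \<in> T" using \<psi> by (simp add: T_def)
    then obtain m where "m \<in> S" "P \<psi> m" using choice unfolding S_def by blast
    then show "r \<in> sat A V (Dia \<psi>)"
      using r(1,2) M unfolding sat_simps cone_below_def P_def by blast
  qed
  then have "\<forall>\<psi>\<in>\<Gamma>. r \<in> sat A V (Dia \<psi>) \<longleftrightarrow> (\<exists>m'\<in>M \<inter> sat A V \<psi>. canonical_rel A z (m' \<inter> B))"
    unfolding P_def Bex_def by (rule ballI)
  with zr False show ?thesis
    by (intro bexI[OF _ r(1)] conjI) (rule impI, erule notE, assumption, rule disjI2)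
qed

text \<open>
  The valuation is pulled back along the imitation \<open>f\<close>. The map \<open>f\<close> does not preserve the accessibility
  relation. For \<open>Dia p\<close> it suffices that both truth at \<open>f z\<close> and truth at \<open>z\<close> amount to the
  existence of a point of \<open>M\<close> above \<open>z\<close> at which \<open>p\<close> holds: a new point \<open>z'\<close> above \<open>z\<close> sees the
  restriction of \<open>f z'\<close>, so by transitivity \<open>z\<close> sees it too.
\<close>

lemma ex_valuation:
  "\<exists>V'. (\<forall>i. V' i \<subseteq> canonical_points (subalg A B)) \<and>
    (\<forall>p. dia_args p \<subseteq> \<Gamma> \<longrightarrow> (w \<inter> B \<in> sat (subalg A B) V' p \<longleftrightarrow> w \<in> sat A V p))"
proof -
  define Q where "Q z m \<longleftrightarrow> m \<in> M \<and> (z \<in> (\<lambda>m. m \<inter> B) ` M \<longrightarrow> z = m \<inter> B) \<and>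
    (z = m \<inter> B \<or> canonical_rel A z (m \<inter> B)) \<and>
    (\<forall>\<psi>\<in>\<Gamma>. m \<in> sat A V (Dia \<psi>) \<longleftrightarrow> (\<exists>m'\<in>M \<inter> sat A V \<psi>. canonical_rel A z (m' \<inter> B)))" for z m
  have "\<forall>z\<in>cone. \<exists>m. Q z m" using ex_imitation unfolding Q_def Bex_def by (rule ballI)
  from bchoice[OF this] obtain f where Q: "\<forall>z\<in>cone. Q z (f z)" ..
  have f: "f z \<in> M" "z \<in> (\<lambda>m. m \<inter> B) ` M \<longrightarrow> z = f z \<inter> B"
    "z = f z \<inter> B \<or> canonical_rel A z (f z \<inter> B)"
    "\<forall>\<psi>\<in>\<Gamma>. f z \<in> sat A V (Dia \<psi>) \<longleftrightarrow>
      (\<exists>m'\<in>M \<inter> sat A V \<psi>. canonical_rel A z (m' \<inter> B))" if "z \<in> cone" for z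
    using bspec[OF Q that] unfolding Q_def by - (elim conjE, assumption)+
  have cone_points: "cone \<subseteq> canonical_points (subalg A B)" by (auto simp: cone_def)
  have cone_up: "z' \<in> cone"
    if "z \<in> cone" "z' \<in> canonical_points (subalg A B)" "canonical_rel A z z'" for z z'
    using that transp_onD[OF S_trans, of "w \<inter> B" z z'] restrict_point w M
    unfolding cone_def by blast
  have fM: "f (m \<inter> B) = m" if "m \<in> M" "m \<inter> B \<in> cone" for m
    using f(1,2)[OF that(2)] that(1) B_separates by blast
  define V' where "V' i = {z \<in> cone. f z \<in> V i}" for i
  have truth: "\<forall>z\<in>cone. z \<in> sat (subalg A B) V' p \<longleftrightarrow> f z \<in> sat A V p" if "dia_args p \<subseteq> \<Gamma>" for p
    using that
  proof (induction p)
    case (Atom i)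
    then show ?case by (simp add: V'_def)
  next
    case Top
    then show ?case using cone_points f(1) M by (auto simp: sat_simps simp del: term_val.simps)
  next
    case (Neg p)
    then show ?case using cone_points f(1) M by (auto simp: sat_simps simp del: term_val.simps)
  next
    case (Or p q)
    then show ?case by (auto simp: sat_simps simp del: term_val.simps)
  next
    case (Dia p)
    then have p: "p \<in> \<Gamma>" and IH: "\<And>z. z \<in> cone \<Longrightarrow> z \<in> sat (subalg A B) V' p \<longleftrightarrow> f z \<in> sat A V p"
      by auto
    have V': "sat (subalg A B) V' p \<subseteq> canonical_points (subalg A B)"
      by (rule sat_points) (use cone_points in \<open>auto simp: V'_def\<close>)
    show ?case
    proof
      fix z assume z: "z \<in> cone"
      have "z \<in> sat (subalg A B) V' (Dia p) \<longleftrightarrow> (\<exists>z'\<in>sat (subalg A B) V' p. canonical_rel A z z')"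
        using z cone_points by (auto simp: sat_simps simp del: term_val.simps)
      also have "\<dots> \<longleftrightarrow> (\<exists>m\<in>M \<inter> sat A V p. canonical_rel A z (m \<inter> B))"
      proof
        assume "\<exists>z'\<in>sat (subalg A B) V' p. canonical_rel A z z'"
        then obtain z' where z': "z' \<in> sat (subalg A B) V' p" "canonical_rel A z z'" by blast
        have c: "z' \<in> cone" using cone_up[OF z _ z'(2)] z'(1) V' by blast
        then have "f z' \<in> M \<inter> sat A V p" using IH z'(1) f(1) by blast
        moreover have "canonical_rel A z (f z' \<inter> B)"
        proof (cases "z' = f z' \<inter> B")
          case True
          then show ?thesis using z'(2) by simp
        next
          case False
          then have "canonical_rel A z' (f z' \<inter> B)" using f(3)[OF c] by blast
          moreover have "f z' \<inter> B \<in> canonical_points (subalg A B)"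
            using f(1)[OF c] M restrict_point by blast
          ultimately show ?thesis
            using transp_onD[OF S_trans _ _ _ z'(2)] z c cone_points by blast
        qed
        ultimately show "\<exists>m\<in>M \<inter> sat A V p. canonical_rel A z (m \<inter> B)" by blast
      next
        assume "\<exists>m\<in>M \<inter> sat A V p. canonical_rel A z (m \<inter> B)"
        then obtain m where m: "m \<in> M" "m \<in> sat A V p" "canonical_rel A z (m \<inter> B)" by blast
        have c: "m \<inter> B \<in> cone" using cone_up[OF z _ m(3)] m(1) M restrict_point by blast
        then have "m \<inter> B \<in> sat (subalg A B) V' p" using IH[OF c] fM[OF m(1) c] m(2) by simp
        then show "\<exists>z'\<in>sat (subalg A B) V' p. canonical_rel A z z'" using m(3) by blast
      qed
      also have "\<dots> \<longleftrightarrow> f z \<in> sat A V (Dia p)" using f(4)[OF z] p by blast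
      finally show "z \<in> sat (subalg A B) V' (Dia p) \<longleftrightarrow> f z \<in> sat A V (Dia p)" .
    qed
  qed
  show ?thesis
  proof (intro exI[of _ V'] conjI allI impI)
    show "V' i \<subseteq> canonical_points (subalg A B)" for i using cone_points by (auto simp: V'_def)
    have "w \<inter> B \<in> cone" using w M restrict_point by (auto simp: cone_def)
    then show "w \<inter> B \<in> sat (subalg A B) V' p \<longleftrightarrow> w \<in> sat A V p" if "dia_args p \<subseteq> \<Gamma>" for p
      using truth[OF that] fM[OF w] by simp
  qed
qed

end

section \<open>Existence of countable reflections\<close>

text \<open>
  The conditions on \<open>M\<close> do not mention \<open>B\<close>, so \<open>M\<close> is closed off first; then \<open>B\<close> is generated from
  the elements that separate the points of \<open>M\<close> and refute the missing instances of the relation,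
  together with the finite sets provided by compactness.
\<close>

lemma (in dia_bao) ex_countable_reflection:
  assumes four: "validates A Four_axiom"
    and width: "validates A (I_axiom n)"
    and w: "w \<in> canonical_points A" and V: "\<And>i. V i \<subseteq> canonical_points A"
    and \<Gamma>: "finite \<Gamma>"
  shows "\<exists>B M. countable B \<and> reflection A B w M V \<Gamma>"
proof -
  let ?W = "canonical_points A"
  have trans: "transp_on ?W (canonical_rel A)" by (rule canonical_rel_trans[OF four])
  have antichains: "\<forall>D \<subseteq> cone_below w {}. pairwise (\<lambda>x y. \<not> canonical_rel A x y) D
      \<longrightarrow> finite D \<and> card D \<le> n"
    by (intro allI impI antichain_card[OF width w])
  have "\<forall>S. \<exists>E. S \<subseteq> ?W \<longrightarrow> finite E \<and> E \<subseteq> cone_below w S \<and>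
      (\<forall>x\<in>cone_below w S. \<exists>r\<in>E. x = r \<or> canonical_rel A x r)"
    (is "\<forall>S. ?C S")
  proof
    show "?C S" for S
    proof (cases "S \<subseteq> ?W")
      case True
      from finite_cofinal_in_cone_below[OF trans antichains this] show ?thesis by simp
    qed simp
  qed
  from choice[OF this] obtain E where E: "\<And>S. S \<subseteq> ?W \<Longrightarrow> finite (E S) \<and> E S \<subseteq> cone_below w S \<and>
      (\<forall>x\<in>cone_below w S. \<exists>r\<in>E S. x = r \<or> canonical_rel A x r)" by blast
  define wit where "wit \<psi> m = (SOME u. u \<in> sat A V \<psi> \<and> canonical_rel A m u)" for \<psi> m
  have wit: "wit \<psi> m \<in> sat A V \<psi> \<and> canonical_rel A m (wit \<psi> m)" if "m \<in> sat A V (Dia \<psi>)" for \<psi> m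
  proof -
    have "\<exists>u. u \<in> sat A V \<psi> \<and> canonical_rel A m u" using that unfolding sat_simps by blast
    then show ?thesis unfolding wit_def by (rule someI_ex)
  qed
  define G where "G S = E S \<union> (\<Union>\<psi>\<in>\<Gamma>. wit \<psi> ` (S \<inter> sat A V (Dia \<psi>)))" for S
  have GS: "countable (G S) \<and> G S \<subseteq> ?W" if S: "finite S" "S \<subseteq> ?W" for S
  proof
    have "finite (G S)" using E[OF S(2)] S(1) \<Gamma> unfolding G_def by blast
    then show "countable (G S)" by (rule countable_finite)
    have "cone_below w S \<subseteq> ?W" by (auto simp: cone_below_def)
    moreover have "wit \<psi> m \<in> ?W" if "m \<in> sat A V (Dia \<psi>)" for \<psi> m
      using wit[OF that] sat_points[of V A, OF V] by blast
    ultimately show "G S \<subseteq> ?W" using E[OF S(2)] unfolding G_def by blast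
  qed
  obtain M where M: "{w} \<subseteq> M" "M \<subseteq> ?W" "countable M"
    and MG: "\<And>S. finite S \<Longrightarrow> S \<subseteq> M \<Longrightarrow> G S \<subseteq> M"
    using countable_closure[of "{w}" ?W G] w GS by auto
  have "\<forall>p. \<exists>a. fst p \<in> ?W \<longrightarrow> snd p \<in> ?W \<longrightarrow> fst p \<noteq> snd p \<longrightarrow> a \<in> carrier A \<and> a \<in> fst p \<and> a \<notin> snd p"
  proof (intro allI)
    fix p :: "'a set \<times> 'a set"
    obtain x y where p: "p = (x, y)" by (cases p)
    have "x = y" if "x \<in> ?W" "y \<in> ?W" "x \<subseteq> y"
      using that uf_alt uf_compl uf_carrier by (metis subset_iff subset_antisym)
    then show "\<exists>a. fst p \<in> ?W \<longrightarrow> snd p \<in> ?W \<longrightarrow> fst p \<noteq> snd p \<longrightarrow> a \<in> carrier A \<and> a \<in> fst p \<and> a \<notin> snd p"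
      unfolding p using uf_carrier by auto
  qed
  from choice[OF this] obtain s where s: "\<And>x y. x \<in> ?W \<Longrightarrow> y \<in> ?W \<Longrightarrow> x \<noteq> y
      \<Longrightarrow> s (x, y) \<in> carrier A \<and> s (x, y) \<in> x \<and> s (x, y) \<notin> y" by auto
  have "\<forall>p. \<exists>a. fst p \<in> ?W \<longrightarrow> snd p \<in> ?W \<longrightarrow> \<not> canonical_rel A (fst p) (snd p)
      \<longrightarrow> a \<in> carrier A \<and> a \<in> snd p \<and> dia A a \<notin> fst p"
    using uf_carrier unfolding canonical_rel_def by blast
  from choice[OF this] obtain t where t: "\<And>x y. x \<in> ?W \<Longrightarrow> y \<in> ?W \<Longrightarrow> \<not> canonical_rel A x y
      \<Longrightarrow> t (x, y) \<in> carrier A \<and> t (x, y) \<in> y \<and> dia A (t (x, y)) \<notin> x" by auto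
  have "\<forall>p. \<exists>D. finite D \<and> D \<subseteq> carrier A \<and> (snd p \<in> carrier A \<longrightarrow> fst p \<subseteq> ?W \<longrightarrow>
      (\<forall>u\<in>cone_below w (fst p). snd p \<notin> u) \<longrightarrow> (\<forall>u\<in>?W. canonical_rel A w u \<longrightarrow> snd p \<in> u
         \<longrightarrow> (\<exists>s\<in>fst p. \<exists>d\<in>D \<inter> s. dia A d \<notin> u)))"
    (is "\<forall>p. ?P p")
  proof
    fix p
    show "?P p"
    proof (cases "snd p \<in> carrier A \<and> fst p \<subseteq> ?W \<and> (\<forall>u\<in>cone_below w (fst p). snd p \<notin> u)")
      case True
      then obtain D where "finite D" "D \<subseteq> carrier A" "\<And>u. u \<in> ?W \<Longrightarrow> canonical_rel A w u
          \<Longrightarrow> snd p \<in> u \<Longrightarrow> \<exists>s\<in>fst p. \<exists>d\<in>D \<inter> s. dia A d \<notin> u"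
        using cone_below_empty_finite[of "fst p" "snd p" w] by metis
      then show ?thesis by (intro exI[of _ D]) simp
    next
      case False
      then show ?thesis by (intro exI[of _ "{}"]) auto
    qed
  qed
  from choice[OF this] obtain D where D: "\<And>S b. finite (D (S, b)) \<and> D (S, b) \<subseteq> carrier A"
    and D': "\<And>S b. b \<in> carrier A \<Longrightarrow> S \<subseteq> ?W \<Longrightarrow> (\<forall>u\<in>cone_below w S. b \<notin> u) \<Longrightarrow>
      \<forall>u\<in>?W. canonical_rel A w u \<longrightarrow> b \<in> u \<longrightarrow> (\<exists>s\<in>S. \<exists>d\<in>D (S, b) \<inter> s. dia A d \<notin> u)"
    by (metis fst_conv snd_conv)
  \<comment> \<open>\<open>s\<close> and \<open>t\<close> are unspecified on pairs that need no witness; the intersection with the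
    carrier discards such values.\<close>
  define B0 where "B0 = {zero A, one A} \<union> ((s ` (M \<times> M) \<union> t ` (M \<times> M)) \<inter> carrier A)"
  define Fin where "Fin = {S. finite S \<and> S \<subseteq> M}"
  define H where "H F = (\<Union>x\<in>F. \<Union>y\<in>F. {join A x y, meet A x y, compl A x, dia A x}) \<union>
    (\<Union>b\<in>F. \<Union>S\<in>Fin. D (S, b))" for F
  have cFin: "countable Fin" unfolding Fin_def using M(3) by (rule countable_Collect_finite_subset)
  have H: "countable (H F) \<and> H F \<subseteq> carrier A" if "finite F" "F \<subseteq> carrier A" for F
  proof
    have "countable (D (S, b))" for S b using D by (intro countable_finite) blast
    then show "countable (H F)"
      unfolding H_def using countable_finite[OF that(1)] cFin by (auto intro!: countable_UN)
    show "H F \<subseteq> carrier A"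
      unfolding H_def using that(2) D
      by (auto intro!: join_closed meet_closed compl_closed dia_closed)
  qed
  have "countable B0" "B0 \<subseteq> carrier A"
    unfolding B0_def using M(3) by (auto simp: zero_closed one_closed intro: countable_Int1)
  from countable_closure[of B0 "carrier A" H, OF this H]
  obtain B where B: "B0 \<subseteq> B" "B \<subseteq> carrier A" "countable B"
    and BH: "\<And>F. finite F \<Longrightarrow> F \<subseteq> B \<Longrightarrow> H F \<subseteq> B" by blast
  have "reflection A B w M V \<Gamma>"
  proof unfold_locales
    show "B \<subseteq> carrier A" "w \<in> M" "M \<subseteq> ?W" "finite \<Gamma>" using B M \<Gamma> by auto
    show "validates A Four_axiom" by (rule four)
    show "zero A \<in> B" "one A \<in> B" using B(1) by (auto simp: B0_def)
    show "join A x y \<in> B" "meet A x y \<in> B" if "x \<in> B" "y \<in> B" for x y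
      using BH[of "{x, y}"] that by (auto simp: H_def)
    show "compl A x \<in> B" "dia A x \<in> B" if "x \<in> B" for x
      using BH[of "{x}"] that by (auto simp: H_def)
  next
    fix S x assume S: "finite S" "S \<subseteq> M" and x: "x \<in> cone_below w S"
    have SW: "S \<subseteq> ?W" using S(2) M(2) by blast
    then obtain r where r: "r \<in> E S" "x = r \<or> canonical_rel A x r" using E x by blast
    have "r \<in> M" using MG[OF S] r(1) unfolding G_def by blast
    moreover have "r \<in> cone_below w S" using E[OF SW] r(1) by blast
    ultimately show "\<exists>r\<in>M \<inter> cone_below w S. x = r \<or> canonical_rel A x r" using r(2) by blast
  next
    fix m \<psi> assume m: "m \<in> M" "\<psi> \<in> \<Gamma>" "m \<in> sat A V (Dia \<psi>)"
    have "wit \<psi> m \<in> G {m}" using m(2,3) unfolding G_def by blast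
    then have "wit \<psi> m \<in> M" using MG[of "{m}"] m(1) by blast
    then show "\<exists>m'\<in>M \<inter> sat A V \<psi>. canonical_rel A m m'" using wit[OF m(3)] by blast
  next
    fix m m' assume m: "m \<in> M" "m' \<in> M" "m \<inter> B = m' \<inter> B"
    show "m = m'"
    proof (rule ccontr)
      assume "m \<noteq> m'"
      then have a: "s (m, m') \<in> carrier A \<and> s (m, m') \<in> m \<and> s (m, m') \<notin> m'" using s m M(2) by blast
      then have "s (m, m') \<in> B" using B(1) m unfolding B0_def by blast
      then show False using a m(3) by blast
    qed
  next
    fix m m' assume m: "m \<in> M" "m' \<in> M" "canonical_rel A (m \<inter> B) (m' \<inter> B)"
    show "canonical_rel A m m'"
    proof (rule ccontr)
      assume "\<not> canonical_rel A m m'"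
      then have a: "t (m, m') \<in> carrier A \<and> t (m, m') \<in> m' \<and> dia A (t (m, m')) \<notin> m"
        using t m M(2) by blast
      then have "t (m, m') \<in> B" using B(1) m unfolding B0_def by blast
      then show False using a canonical_relD[OF m(3), of "t (m, m')"] by blast
    qed
  next
    fix S b assume S: "finite S" "S \<subseteq> M" and b: "b \<in> B" "\<forall>u\<in>cone_below w S. b \<notin> u"
    have "D (S, b) \<subseteq> H {b}" using S unfolding H_def Fin_def by blast
    then have "D (S, b) \<subseteq> B" using BH[of "{b}"] b(1) by blast
    moreover have "S \<subseteq> ?W" "b \<in> carrier A" using S M(2) b(1) B(2) by auto
    ultimately show "\<exists>D\<subseteq>B. finite D \<and> (\<forall>u\<in>?W. canonical_rel A w u \<longrightarrow> b \<in> u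
        \<longrightarrow> (\<exists>s\<in>S. \<exists>d\<in>D \<inter> s. dia A d \<notin> u))"
      using D' D b(2) by (intro exI[of _ "D (S, b)"]) blast
  qed
  then show ?thesis using B(3) by blast
qed

theorem mainTheorem3:
  fixes n :: nat and L :: "fm set"
  assumes "0 < n"
    and "normal_modal_logic L"
    and "K4I n \<subseteq> L"
    and "kappa_canonical natLeq TYPE(nat) L"
  shows "totally_canonical TYPE('a) L"
  unfolding totally_canonical_def
proof (intro allI impI)
  fix A :: "'a bao"
  assume A: "in_variety A L"
  interpret A: dia_bao A using A by (simp add: in_variety_def)
  have "Four_axiom \<in> L" "I_axiom n \<in> L" using assms(3) by (auto simp: K4I_def)
  then have four: "validates A Four_axiom" and width: "validates A (I_axiom n)"
    using A by (auto simp: in_variety_def validates_def)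
  have omega: "kappa_canonical natLeq TYPE('a) L"
    using assms(4) by (rule omega_canonical_all_types)
  have ext: "carrier (canonical_extension C) = Pow (canonical_points C)"
    "one (canonical_extension C) = canonical_points C" for C :: "'a bao"
    by (simp_all add: canonical_extension_def complex_algebra_def)
  have "sat A V p = canonical_points A" if p: "p \<in> L" and V: "\<And>i. V i \<subseteq> canonical_points A" for p V
  proof (rule ccontr)
    assume "sat A V p \<noteq> canonical_points A"
    then obtain w where w: "w \<in> canonical_points A" "w \<notin> sat A V p"
      using sat_points[of V A, OF V] by blast
    obtain B M where cB: "countable B" and reflects: "reflection A B w M V (dia_args p)"
      using A.ex_countable_reflection[where V = V, OF four width w(1) V finite_dia_args] by blast
    interpret R: reflection A B w M V "dia_args p" by (rule reflects)
    obtain V' where V': "\<And>i. V' i \<subseteq> canonical_points (subalg A B)"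
      and refuted: "w \<inter> B \<notin> sat (subalg A B) V' p"
      using R.ex_valuation w(2) by auto
    have "in_variety (subalg A B) L"
      unfolding in_variety_def
    proof (intro conjI ballI allI impI)
      show "dia_bao (subalg A B)" by (rule R.dia_bao_subalg)
      fix q and v :: "nat \<Rightarrow> 'a" assume "q \<in> L" "\<forall>i. v i \<in> carrier (subalg A B)"
      then show "term_val (subalg A B) v q = one (subalg A B)"
        using A R.sub by (auto simp: in_variety_def subset_iff)
    qed
    moreover have "|B| \<le>o natLeq" using cB by (simp add: countable_card_le_natLeq)
    then have "\<exists>G\<subseteq>carrier (subalg A B). |G| \<le>o natLeq \<and>
        generated (subalg A B) G = carrier (subalg A B)"
      using R.generated_subalg by (intro exI[of _ B]) simp
    ultimately have "in_variety (canonical_extension (subalg A B)) L"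
      using omega unfolding kappa_canonical_def by blast
    then have "sat (subalg A B) V' p = canonical_points (subalg A B)"
      using p V' by (auto simp: in_variety_def ext)
    then show False using refuted R.restrict_point[OF w(1)] by simp
  qed
  then show "in_variety (canonical_extension A) L"
    unfolding in_variety_def ext
    by (auto simp: canonical_extension_def dia_bao_complex_algebra)
qed

end
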